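(* Let $f:\mathbb{R}^n\to(-\infty,+\infty]$ be proper, lower semicontinuous and prox-bounded with threshold $\lambda_f>0$, and suppose $f$ is prox-regular at $\bar x$ for $\bar v\in\partial f(\bar x)$. Then there exists $0<\bar\lambda\le\lambda_f$ such that for every $0<\lambda<\bar\lambda$ one has $P_\lambda f(\bar x+\lambda\bar v)=\{\bar x\}$, and there exists (for each such $\lambda$) an open convex neighborhood $U_\lambda$ of $\bar x+\lambda\bar v$ such that, with $W_\lambda:=\{(x,v)\in\mathbb{R}^n\times\mathbb{R}^n:\ x+\lambda v\in U_\lambda\}$, the following properties are equivalent: (a) $f$ is variationally convex at $\bar x$ for $\bar v$; (b) for all $0<\lambda<\bar\lambda$, $\partial_p^\lambda f$ is monotone relative to $W_\lambda$; (c) for all $0<\lambda<\bar\lambda$, $\partial_p^\lambda f$ is maximally monotone relative to $W_\lambda$; (d) for all $0<\lambda<\bar\lambda$, $P_\lambda f$ is firmly nonexpansive on $U_\lambda$; (e) for all $0<\lambda<\bar\lambda$ there is $0<\alpha<1$ such that $P_\lambda f$ is $\alpha$-averaged on $U_\lambda$; (f) for all $0<\lambda<\bar\lambda$, $P_\lambda f$ is nonexpansive on $U_\lambda$; (g) for all $0<\lambda<\bar\lambda$, $e_\lambda f$ is convex on $U_\lambda$; (h) there exists $0<\lambda<\bar\lambda$ such that $e_\lambda f$ is convex on $U_\lambda$; (i) for all $0<\lambda<\bar\lambda$, $\nabla e_\lambda f$ is $\lambda$-cocoercive on $U_\lambda$.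
   Context: $j:=\frac12\|\cdot\|^2$. For $\lambda>0$: $e_\lambda f(x):=\inf_{y}\{f(y)+\frac1{2\lambda}\|y-x\|^2\}$ (Moreau envelope) and $P_\lambda f(x):=\operatorname{argmin}_y\{f(y)+\frac1{2\lambda}\|y-x\|^2\}$ (set-valued proximal mapping). $f$ is prox-bounded if $e_\lambda f(x)>-\infty$ for some $\lambda>0$ and some $x$; the threshold $\lambda_f$ is the supremum of all such $\lambda$. The $\lambda$-level proximal subdifferential: for $x\in\operatorname{dom} f$, $v\in\partial_p^\lambda f(x)$ iff $f(y)\ge f(x)+\langle v,y-x\rangle-\frac1{2\lambda}\|y-x\|^2$ for all $y\in\mathbb{R}^n$; $\partial_p^\lambda f(x)=\varnothing$ if $x\notin\operatorname{dom}f$. $\partial f$ is the limiting (Mordukhovich) subdifferential. $f$ is prox-regular at $\bar x$ for $\bar v\in\partial f(\bar x)$ if there are $\varepsilon>0,\rho\ge0$ with $f(y)\ge f(x)+\langle v,y-x\rangle-\frac\rho2\|y-x\|^2$ for all $y\in\mathbb B_\varepsilon(\bar x)$ whenever $v\in\partial f(x)$, $\|v-\bar v\|<\varepsilon$, $\|x-\bar x\|<\varepsilon$, $f(x)<f(\bar x)+\varepsilon$. $f$ is variationally convex at $\bar x$ for $\bar v\in\partial f(\bar x)$ if for some convex neighborhood $U\times V$ of $(\bar x,\bar v)$ there are a lsc convex function $\varphi\le f$ on $U$ and $\varepsilon>0$ such that $[U_\varepsilon\times V]\cap\operatorname{gph}\partial f=[U\times V]\cap\operatorname{gph}\partial\varphi$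 and $f(x)=\varphi(x)$ at the common elements $(x,v)$, where $U_\varepsilon=\{x\in U: f(x)<f(\bar x)+\varepsilon\}$. A set-valued $A$ is monotone relative to $W\subseteq\mathbb{R}^n\times\mathbb{R}^n$ if $\langle x_1-x_2,v_1-v_2\rangle\ge0$ for all $(x_i,v_i)\in\operatorname{gph}A\cap W$; it is maximally monotone relative to $W$ if no $A'$ monotone relative to $W$ has $\operatorname{gph}A'\cap W$ strictly containing $\operatorname{gph}A\cap W$. On a set $U$: $T$ firmly nonexpansive means $\|Tx-Ty\|^2\le\langle x-y,Tx-Ty\rangle$; $\lambda$-cocoercive means $\lambda T$ firmly nonexpansive; $\alpha$-averaged means $T=(1-\alpha)\mathrm{Id}+\alpha N$ with $N$ nonexpansive on $U$. *)

theory Defs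
  imports "HOL-Analysis.Analysis"
begin

text \<open>Extended-real-valued functions f :: 'a \<Rightarrow> ereal on a Euclidean space model
  functions into (-\<infinity>, +\<infinity>] (the value -\<infinity> is excluded by properness).\<close>

definition proper_fun :: "('a \<Rightarrow> ereal) \<Rightarrow> bool" where
  "proper_fun f \<longleftrightarrow> (\<forall>x. f x \<noteq> -\<infinity>) \<and> (\<exists>x. f x \<noteq> \<infinity>)"

definition lsc_fun :: "('a::topological_space \<Rightarrow> ereal) \<Rightarrow> bool" where
  "lsc_fun f \<longleftrightarrow> (\<forall>x X. X \<longlonglongrightarrow> x \<longrightarrow> f x \<le> liminf (\<lambda>k. f (X k)))"

definition moreau_env :: "real \<Rightarrow> ('a::real_inner \<Rightarrow> ereal) \<Rightarrow> 'a \<Rightarrow> ereal" where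
  "moreau_env lam f x = (INF y. f y + ereal (1 / (2 * lam) * (norm (y - x))\<^sup>2))"

definition prox_map :: "real \<Rightarrow> ('a::real_inner \<Rightarrow> ereal) \<Rightarrow> 'a \<Rightarrow> 'a set" where
  "prox_map lam f x = {y. \<forall>z. f y + ereal (1 / (2 * lam) * (norm (y - x))\<^sup>2)
                              \<le> f z + ereal (1 / (2 * lam) * (norm (z - x))\<^sup>2)}"

definition prox_bounded :: "('a::real_inner \<Rightarrow> ereal) \<Rightarrow> bool" where
  "prox_bounded f \<longleftrightarrow> (\<exists>lam>0. \<exists>x. moreau_env lam f x > -\<infinity>)"

definition prox_threshold :: "('a::real_inner \<Rightarrow> ereal) \<Rightarrow> ereal" where
  "prox_threshold f = Sup {ereal lam | lam. lam > 0 \<and> (\<exists>x. moreau_env lam f x > -\<infinity>)}"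

definition prox_subdiff_level :: "real \<Rightarrow> ('a::real_inner \<Rightarrow> ereal) \<Rightarrow> 'a \<Rightarrow> 'a set" where
  "prox_subdiff_level lam f x =
     (if \<bar>f x\<bar> \<noteq> \<infinity> then {v. \<forall>y. f y \<ge> f x + ereal (inner v (y - x) - 1 / (2 * lam) * (norm (y - x))\<^sup>2)}
      else {})"

definition regular_subdiff :: "('a::real_inner \<Rightarrow> ereal) \<Rightarrow> 'a \<Rightarrow> 'a set" where
  "regular_subdiff f x =
     (if \<bar>f x\<bar> \<noteq> \<infinity> then {v. \<forall>e>0. \<exists>d>0. \<forall>y. norm (y - x) < d \<longrightarrow>
                     f y \<ge> f x + ereal (inner v (y - x) - e * norm (y - x))}
      else {})"

definition limiting_subdiff :: "('a::real_inner \<Rightarrow> ereal) \<Rightarrow> 'a \<Rightarrow> 'a set" where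
  "limiting_subdiff f x =
     (if \<bar>f x\<bar> \<noteq> \<infinity> then {v. \<exists>X V. X \<longlonglongrightarrow> x \<and> (\<lambda>k. f (X k)) \<longlonglongrightarrow> f x \<and> V \<longlonglongrightarrow> v \<and>
                                   (\<forall>k. V k \<in> regular_subdiff f (X k))}
      else {})"

definition prox_regular_at :: "('a::real_inner \<Rightarrow> ereal) \<Rightarrow> 'a \<Rightarrow> 'a \<Rightarrow> bool" where
  "prox_regular_at f xb vb \<longleftrightarrow> vb \<in> limiting_subdiff f xb \<and>
     (\<exists>e>0. \<exists>rho\<ge>0. \<forall>x v. v \<in> limiting_subdiff f x \<and> norm (v - vb) < e \<and> norm (x - xb) < e
         \<and> f x < f xb + ereal e \<longrightarrow>
         (\<forall>y\<in>cball xb e. f y \<ge> f x + ereal (inner v (y - x) - rho / 2 * (norm (y - x))\<^sup>2)))"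

definition ereal_convex_on :: "'a::real_vector set \<Rightarrow> ('a \<Rightarrow> ereal) \<Rightarrow> bool" where
  "ereal_convex_on U g \<longleftrightarrow> convex {(x, r::real). x \<in> U \<and> g x \<le> ereal r}"

definition variationally_convex_at :: "('a::real_inner \<Rightarrow> ereal) \<Rightarrow> 'a \<Rightarrow> 'a \<Rightarrow> bool" where
  "variationally_convex_at f xb vb \<longleftrightarrow> vb \<in> limiting_subdiff f xb \<and>
     (\<exists>U V phi e. convex U \<and> convex V \<and> xb \<in> interior U \<and> vb \<in> interior V \<and>
        lsc_fun phi \<and> ereal_convex_on UNIV phi \<and> (\<forall>x\<in>U. phi x \<le> f x) \<and> e > 0 \<and>
        (\<forall>x v. (x \<in> U \<and> f x < f xb + ereal e \<and> v \<in> V \<and> v \<in> limiting_subdiff f x)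
                 \<longleftrightarrow> (x \<in> U \<and> v \<in> V \<and> v \<in> limiting_subdiff phi x)) \<and>
        (\<forall>x v. x \<in> U \<and> f x < f xb + ereal e \<and> v \<in> V \<and> v \<in> limiting_subdiff f x \<longrightarrow> f x = phi x))"

definition monotone_rel :: "('a::real_inner \<Rightarrow> 'a set) \<Rightarrow> ('a \<times> 'a) set \<Rightarrow> bool" where
  "monotone_rel A W \<longleftrightarrow> (\<forall>x1 v1 x2 v2. v1 \<in> A x1 \<and> (x1, v1) \<in> W \<and> v2 \<in> A x2 \<and> (x2, v2) \<in> W
      \<longrightarrow> inner (x1 - x2) (v1 - v2) \<ge> 0)"

definition graph_of :: "('a \<Rightarrow> 'b set) \<Rightarrow> ('a \<times> 'b) set" where
  "graph_of A = {(x, v). v \<in> A x}"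

definition max_monotone_rel :: "('a::real_inner \<Rightarrow> 'a set) \<Rightarrow> ('a \<times> 'a) set \<Rightarrow> bool" where
  "max_monotone_rel A W \<longleftrightarrow> monotone_rel A W \<and>
     \<not> (\<exists>A'. monotone_rel A' W \<and> graph_of A \<inter> W \<subset> graph_of A' \<inter> W)"

definition firmly_nonexp_on :: "'a::real_inner set \<Rightarrow> ('a \<Rightarrow> 'a set) \<Rightarrow> bool" where
  "firmly_nonexp_on U T \<longleftrightarrow> (\<forall>x\<in>U. \<forall>y\<in>U. \<forall>p\<in>T x. \<forall>q\<in>T y.
       (norm (p - q))\<^sup>2 \<le> inner (x - y) (p - q))"

definition nonexp_on :: "'a::real_inner set \<Rightarrow> ('a \<Rightarrow> 'a set) \<Rightarrow> bool" where
  "nonexp_on U T \<longleftrightarrow> (\<forall>x\<in>U. \<forall>y\<in>U. \<forall>p\<in>T x. \<forall>q\<in>T y. norm (p - q) \<le> norm (x - y))"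

definition averaged_on :: "real \<Rightarrow> 'a::real_inner set \<Rightarrow> ('a \<Rightarrow> 'a set) \<Rightarrow> bool" where
  "averaged_on alpha U T \<longleftrightarrow> (\<exists>N. nonexp_on U (\<lambda>x. {N x}) \<and>
       (\<forall>x\<in>U. T x = {(1 - alpha) *\<^sub>R x + alpha *\<^sub>R N x}))"

definition cocoercive_on :: "real \<Rightarrow> 'a::real_inner set \<Rightarrow> ('a \<Rightarrow> 'a) \<Rightarrow> bool" where
  "cocoercive_on lam U T \<longleftrightarrow> firmly_nonexp_on U (\<lambda>x. {lam *\<^sub>R T x})"

definition grad_cocoercive_on :: "real \<Rightarrow> 'a::real_inner set \<Rightarrow> ('a \<Rightarrow> ereal) \<Rightarrow> bool" where
  "grad_cocoercive_on lam U g \<longleftrightarrow> (\<exists>G. (\<forall>x\<in>U. \<bar>g x\<bar> \<noteq> \<infinity> \<and>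
        ((\<lambda>y. real_of_ereal (g y)) has_derivative (\<lambda>h. inner (G x) h)) (at x))
      \<and> cocoercive_on lam U G)"

end

theory Submission
  imports Defs
begin

text \<open>
  Prox-regularity at \<open>xb\<close> together with prox-boundedness gives a global quadratic minorant
  \<open>f y \<ge> f xb + inner vb (y - xb) - r / 2 * (norm (y - xb))\<^sup>2\<close>, and \<open>1 / r\<close> serves as the bound
  on \<open>lam\<close>. Below it proximal points exist, and those of \<open>u\<close> near \<open>xb + lam *\<^sub>R vb\<close> are close to
  \<open>xb\<close> with proximal subgradients close to \<open>vb\<close>, by compactness.

  Under variational convexity these subgradients belong to a convex function, and their monotonicity
  is firm nonexpansiveness of the proximal mapping, from which the other properties follow in a chain
  ending with convexity of the envelope for a single \<open>lam\<close>. The latter gives a local subgradient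
  inequality \<open>f y \<ge> f x + inner v (y - x)\<close>, uniform in \<open>(x, v)\<close> near \<open>(xb, vb)\<close> in the
  (\<open>f\<close>-attentive) graph of the limiting subdifferential. The supremum of these affine minorants is
  the convex function required for variational convexity; that it has no further subgradients near
  \<open>(xb, vb)\<close> follows from monotonicity and the existence of proximal points.
\<close>

section \<open>Proximal points and subgradients\<close>

lemma limiting_subdiff_finite:
  assumes "v \<in> limiting_subdiff f x"
  obtains c where "f x = ereal c"
  using assms by (cases "f x") (auto simp: limiting_subdiff_def)

lemma prox_map_finite:
  assumes "proper_fun f" "p \<in> prox_map lam f u"
  obtains c where "f p = ereal c"
proof -
  obtain z where z: "f z \<noteq> \<infinity>" using assms(1) by (auto simp: proper_fun_def)
  have "f p + ereal (1 / (2 * lam) * (norm (p - u))\<^sup>2) \<le> f z + ereal (1 / (2 * lam) * (norm (z - u))\<^sup>2)"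
    using assms(2) by (auto simp: prox_map_def)
  moreover have "f p \<noteq> -\<infinity>" "f z \<noteq> -\<infinity>" using assms(1) by (auto simp: proper_fun_def)
  ultimately have "\<exists>c. f p = ereal c" using z by (cases "f p"; cases "f z") auto
  then show ?thesis using that by blast
qed

text \<open>Completing the square: with \<open>u = x + lam *\<^sub>R v\<close>, the penalty at
  \<open>z\<close> centred at \<open>u\<close> equals the penalty centred at \<open>x\<close>, minus
  \<open>inner v (z - x)\<close>, plus a constant. Minimality of \<open>x\<close> is therefore the
  subgradient inequality itself.\<close>

lemma prox_subdiff_level_iff_prox_map:
  fixes f :: "'a::real_inner \<Rightarrow> ereal"
  assumes "proper_fun f" "0 < lam"
  shows "v \<in> prox_subdiff_level lam f x \<longleftrightarrow> x \<in> prox_map lam f (x + lam *\<^sub>R v)"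
proof -
  have eq: "(f x + ereal (1 / (2 * lam) * (norm (x - (x + lam *\<^sub>R v)))\<^sup>2)
              \<le> f z + ereal (1 / (2 * lam) * (norm (z - (x + lam *\<^sub>R v)))\<^sup>2)) \<longleftrightarrow>
            (f z \<ge> f x + ereal (inner v (z - x) - 1 / (2 * lam) * (norm (z - x))\<^sup>2))"
    if c: "f x = ereal c" for z c
  proof -
    have "1 / (2 * lam) * (norm (z - (x + lam *\<^sub>R v)))\<^sup>2
          = 1 / (2 * lam) * (norm (z - x))\<^sup>2 - inner v (z - x)
            + 1 / (2 * lam) * (norm (x - (x + lam *\<^sub>R v)))\<^sup>2"
      using assms(2) unfolding power2_norm_eq_inner
      by (simp add: inner_diff_left inner_diff_right inner_add_left inner_add_right inner_commute field_simps)
    then show ?thesis using c by (cases "f z") (auto simp: algebra_simps)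
  qed
  show ?thesis
  proof
    assume v: "v \<in> prox_subdiff_level lam f x"
    then obtain c where "f x = ereal c"
      by (cases "f x") (auto simp: prox_subdiff_level_def)
    with v eq show "x \<in> prox_map lam f (x + lam *\<^sub>R v)"
      by (auto simp: prox_subdiff_level_def prox_map_def)
  next
    assume x: "x \<in> prox_map lam f (x + lam *\<^sub>R v)"
    then obtain c where "f x = ereal c" using prox_map_finite assms(1) by blast
    with x eq show "v \<in> prox_subdiff_level lam f x"
      by (auto simp: prox_subdiff_level_def prox_map_def)
  qed
qed

lemma regular_subset_limiting_subdiff: "regular_subdiff f x \<subseteq> limiting_subdiff f x"
proof
  fix v assume v: "v \<in> regular_subdiff f x"
  then have "\<bar>f x\<bar> \<noteq> \<infinity>" by (auto simp: regular_subdiff_def split: if_splits)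
  moreover have "\<exists>X V. X \<longlonglongrightarrow> x \<and> (\<lambda>k. f (X k)) \<longlonglongrightarrow> f x \<and> V \<longlonglongrightarrow> v \<and>
       (\<forall>k. V k \<in> regular_subdiff f (X k))"
    by (rule exI[of _ "\<lambda>_. x"], rule exI[of _ "\<lambda>_. v"]) (use v in auto)
  ultimately show "v \<in> limiting_subdiff f x" by (auto simp: limiting_subdiff_def)
qed

text \<open>A quadratic error is \<open>o(norm (y - x))\<close>: within radius
  \<open>e / (K + 1)\<close> it is at most \<open>e * norm (y - x)\<close>. So \<open>v\<close> is
  already a regular subgradient.\<close>

lemma quadratic_minorant_imp_limiting_subdiff:
  fixes f :: "'a::real_inner \<Rightarrow> ereal"
  assumes c: "f x = ereal c" and K: "0 \<le> K"
    and le: "\<And>y. f y \<ge> f x + ereal (inner v (y - x) - K * (norm (y - x))\<^sup>2)"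
  shows "v \<in> limiting_subdiff f x"
proof -
  have "\<exists>d>0. \<forall>y. norm (y - x) < d \<longrightarrow> f y \<ge> f x + ereal (inner v (y - x) - e * norm (y - x))"
    if e: "e > 0" for e
  proof (intro exI[of _ "e / (K + 1)"] conjI allI impI)
    show "0 < e / (K + 1)" using e K by simp
    fix y assume y: "norm (y - x) < e / (K + 1)"
    then have "norm (y - x) * (K + 1) < e" using K by (simp add: field_simps)
    then have "norm (y - x) + K * norm (y - x) < e" by (simp add: algebra_simps)
    then have "K * norm (y - x) \<le> e" using norm_ge_zero[of "y - x"] by linarith
    then have "K * norm (y - x) * norm (y - x) \<le> e * norm (y - x)"
      by (intro mult_right_mono) auto
    then have "ereal (inner v (y - x) - e * norm (y - x)) \<le> ereal (inner v (y - x) - K * (norm (y - x))\<^sup>2)"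
      by (simp add: power2_eq_square)
    then show "f x + ereal (inner v (y - x) - e * norm (y - x)) \<le> f y"
      using le[of y] by (meson add_left_mono order_trans)
  qed
  then have "v \<in> regular_subdiff f x" using c by (auto simp: regular_subdiff_def)
  then show ?thesis using regular_subset_limiting_subdiff by blast
qed

lemma prox_subdiff_level_subset_limiting:
  assumes "0 < lam"
  shows "prox_subdiff_level lam f x \<subseteq> limiting_subdiff f x"
proof
  fix v assume v: "v \<in> prox_subdiff_level lam f x"
  then obtain c where c: "f x = ereal c"
    by (cases "f x") (auto simp: prox_subdiff_level_def)
  show "v \<in> limiting_subdiff f x"
    by (rule quadratic_minorant_imp_limiting_subdiff[where f = f and K = "1 / (2 * lam)", OF c])
       (use v assms in \<open>auto simp: prox_subdiff_level_def split: if_splits\<close>)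
qed

section \<open>Monotonicity, firm nonexpansiveness and averagedness\<close>

text \<open>The graph points \<open>(p, v)\<close> correspond to \<open>p\<close> in the proximal
  set of \<open>u = p + lam *\<^sub>R v\<close>, with \<open>v = (u - p) / lam\<close>. Under this
  change of variables the two inequalities differ only by the factor \<open>lam\<close>.\<close>

lemma monotone_rel_iff_firmly_nonexp:
  fixes f :: "'a::real_inner \<Rightarrow> ereal"
  assumes "proper_fun f" "0 < lam"
  shows "monotone_rel (prox_subdiff_level lam f) {(x, v). x + lam *\<^sub>R v \<in> U}
     \<longleftrightarrow> firmly_nonexp_on U (prox_map lam f)" (is "?L \<longleftrightarrow> ?R")
proof -
  note iff = prox_subdiff_level_iff_prox_map[OF assms]
  have id: "inner (u - w) (p - q) - (norm (p - q))\<^sup>2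
       = lam * inner (p - q) ((1/lam) *\<^sub>R (u - p) - (1/lam) *\<^sub>R (w - q))" for p q u w :: 'a
  proof -
    have "lam *\<^sub>R ((1/lam) *\<^sub>R (u - p) - (1/lam) *\<^sub>R (w - q)) = (u - w) - (p - q)"
      using assms(2) by (simp add: scaleR_diff_right)
    then have "lam * inner (p - q) ((1/lam) *\<^sub>R (u - p) - (1/lam) *\<^sub>R (w - q))
        = inner (p - q) ((u - w) - (p - q))" by (metis inner_scaleR_right)
    then show ?thesis
      by (simp add: power2_norm_eq_inner inner_diff_right inner_commute)
  qed
  show ?thesis
  proof
    assume L: ?L
    show ?R unfolding firmly_nonexp_on_def
    proof (intro ballI)
      fix u w p q assume h: "u \<in> U" "w \<in> U" "p \<in> prox_map lam f u" "q \<in> prox_map lam f w"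
      have "(1/lam) *\<^sub>R (u - p) \<in> prox_subdiff_level lam f p"
        "(1/lam) *\<^sub>R (w - q) \<in> prox_subdiff_level lam f q"
        using h assms(2) by (simp_all add: iff)
      moreover have "p + lam *\<^sub>R (1/lam) *\<^sub>R (u - p) \<in> U" "q + lam *\<^sub>R (1/lam) *\<^sub>R (w - q) \<in> U"
        using h assms(2) by simp_all
      ultimately have "inner (p - q) ((1/lam) *\<^sub>R (u - p) - (1/lam) *\<^sub>R (w - q)) \<ge> 0"
        using L unfolding monotone_rel_def by blast
      then show "(norm (p - q))\<^sup>2 \<le> inner (u - w) (p - q)"
        using id[of u w p q] assms(2) by (smt (verit) mult_nonneg_nonneg)
    qed
  next
    assume R: ?R
    show ?L unfolding monotone_rel_def
    proof (intro allI impI, elim conjE)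
      fix x1 v1 x2 v2
      assume h: "v1 \<in> prox_subdiff_level lam f x1" "v2 \<in> prox_subdiff_level lam f x2"
        "(x1, v1) \<in> {(x, v). x + lam *\<^sub>R v \<in> U}" "(x2, v2) \<in> {(x, v). x + lam *\<^sub>R v \<in> U}"
      have "(norm (x1 - x2))\<^sup>2 \<le> inner ((x1 + lam *\<^sub>R v1) - (x2 + lam *\<^sub>R v2)) (x1 - x2)"
        using R h iff unfolding firmly_nonexp_on_def by auto
      then have "0 \<le> lam * inner (x1 - x2) (v1 - v2)"
        using id[of "x1 + lam *\<^sub>R v1" "x2 + lam *\<^sub>R v2" x1 x2] assms(2) by simp
      then show "0 \<le> inner (x1 - x2) (v1 - v2)" using assms(2) by (simp add: zero_le_mult_iff)
    qed
  qed
qed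

text \<open>Minty's argument. Because the resolvent is defined everywhere, an additional point
  \<open>(x, v)\<close> of a monotone extension can be compared with a graph point
  \<open>(p, w)\<close> having the same
  \<open>u = x + lam *\<^sub>R v = p + lam *\<^sub>R w\<close>. Then \<open>x - p\<close> is a
  negative multiple of \<open>v - w\<close>, so monotonicity forces the two points to
  coincide.\<close>

lemma max_monotone_rel_iff_monotone_rel:
  fixes f :: "'a::real_inner \<Rightarrow> ereal"
  assumes "proper_fun f" "0 < lam" and ne: "\<And>u. prox_map lam f u \<noteq> {}"
  defines "W \<equiv> \<lambda>U. {(x, v). x + lam *\<^sub>R v \<in> U}"
  shows "max_monotone_rel (prox_subdiff_level lam f) (W U)
     \<longleftrightarrow> monotone_rel (prox_subdiff_level lam f) (W U)"
proof
  assume m: "monotone_rel (prox_subdiff_level lam f) (W U)"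
  have False if A': "monotone_rel A' (W U)"
    and sub: "graph_of (prox_subdiff_level lam f) \<inter> W U \<subset> graph_of A' \<inter> W U" for A'
  proof -
    obtain x v where xv: "(x, v) \<in> graph_of A' \<inter> W U" "(x, v) \<notin> graph_of (prox_subdiff_level lam f)"
      using sub by auto
    define u where "u = x + lam *\<^sub>R v"
    obtain p where p: "p \<in> prox_map lam f u" using ne by blast
    define w where "w = (1/lam) *\<^sub>R (u - p)"
    have u: "u = p + lam *\<^sub>R w" using assms(2) by (simp add: w_def)
    have w: "w \<in> prox_subdiff_level lam f p"
      using p u by (simp add: prox_subdiff_level_iff_prox_map[OF assms(1,2)])
    have "u \<in> U" using xv by (simp add: W_def u_def)
    then have "(p, w) \<in> W U" using u by (simp add: W_def)
    then have "(p, w) \<in> graph_of A' \<inter> W U" using w sub by (auto simp: graph_of_def)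
    then have "0 \<le> inner (x - p) (v - w)"
      using A' xv unfolding monotone_rel_def graph_of_def by auto
    moreover have "x - p = - (lam *\<^sub>R (v - w))" using u u_def by (simp add: algebra_simps)
    ultimately have "lam * inner (v - w) (v - w) \<le> 0" by simp
    then have "inner (v - w) (v - w) \<le> 0" using assms(2) by (simp add: mult_le_0_iff)
    then have "v = w" using inner_ge_zero[of "v - w"] inner_eq_zero_iff[of "v - w"] by auto
    then have "x = p" using u u_def by simp
    then show False using xv w \<open>v = w\<close> by (simp add: graph_of_def)
  qed
  with m show "max_monotone_rel (prox_subdiff_level lam f) (W U)"
    unfolding max_monotone_rel_def by blast
qed (simp add: max_monotone_rel_def)

text \<open>Firm nonexpansiveness at a pair \<open>x = y\<close> gives single values on
  \<open>U\<close>. The nonexpansive part is then the reflection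
  \<open>2 *\<^sub>R P x - x\<close>.\<close>

lemma firmly_nonexp_imp_averaged:
  assumes F: "firmly_nonexp_on U T" and ne: "\<And>u. T u \<noteq> {}"
  shows "averaged_on (1/2) U T"
proof -
  define P where "P u = (SOME p. p \<in> T u)" for u
  have P: "P u \<in> T u" for u using ne[of u] unfolding P_def by (simp add: some_in_eq)
  have single: "T u = {P u}" if "u \<in> U" for u
  proof -
    have "q = P u" if "q \<in> T u" for q
    proof -
      have "(norm (q - P u))\<^sup>2 \<le> inner (u - u) (q - P u)"
        using F P \<open>u \<in> U\<close> that unfolding firmly_nonexp_on_def by blast
      then show ?thesis by simp
    qed
    then show ?thesis using P by blast
  qed
  have "norm ((2 *\<^sub>R P x - x) - (2 *\<^sub>R P y - y)) \<le> norm (x - y)" if "x \<in> U" "y \<in> U" for x y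
  proof -
    have "(norm (P x - P y))\<^sup>2 \<le> inner (x - y) (P x - P y)"
      using F P that unfolding firmly_nonexp_on_def by blast
    moreover have "(norm ((2 *\<^sub>R P x - x) - (2 *\<^sub>R P y - y)))\<^sup>2
        = 4 * (norm (P x - P y))\<^sup>2 - 4 * inner (x - y) (P x - P y) + (norm (x - y))\<^sup>2"
      by (simp add: power2_norm_eq_inner inner_simps inner_commute)
    ultimately have "(norm ((2 *\<^sub>R P x - x) - (2 *\<^sub>R P y - y)))\<^sup>2 \<le> (norm (x - y))\<^sup>2" by simp
    then show ?thesis by (rule power2_le_imp_le) simp
  qed
  then show ?thesis unfolding averaged_on_def
    by (intro exI[of _ "\<lambda>x. 2 *\<^sub>R P x - x"]) (auto simp: nonexp_on_def single algebra_simps)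
qed

lemma averaged_imp_nonexp:
  assumes "averaged_on alpha U T" "0 < alpha" "alpha < 1"
  shows "nonexp_on U T"
proof -
  obtain N where N: "nonexp_on U (\<lambda>x. {N x})"
    "\<And>x. x \<in> U \<Longrightarrow> T x = {(1 - alpha) *\<^sub>R x + alpha *\<^sub>R N x}"
    using assms(1) by (auto simp: averaged_on_def)
  have "norm (((1 - alpha) *\<^sub>R x + alpha *\<^sub>R N x) - ((1 - alpha) *\<^sub>R y + alpha *\<^sub>R N y)) \<le> norm (x - y)"
    if "x \<in> U" "y \<in> U" for x y
  proof -
    have "((1 - alpha) *\<^sub>R x + alpha *\<^sub>R N x) - ((1 - alpha) *\<^sub>R y + alpha *\<^sub>R N y)
      = (1 - alpha) *\<^sub>R (x - y) + alpha *\<^sub>R (N x - N y)" by (simp add: algebra_simps)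
    also have "norm \<dots> \<le> (1 - alpha) * norm (x - y) + alpha * norm (N x - N y)"
      using norm_triangle_ineq[of "(1 - alpha) *\<^sub>R (x - y)" "alpha *\<^sub>R (N x - N y)"] assms by simp
    also have "\<dots> \<le> (1 - alpha) * norm (x - y) + alpha * norm (x - y)"
      using N(1) that assms by (auto simp: nonexp_on_def)
    finally show ?thesis by (simp add: algebra_simps)
  qed
  then show ?thesis using N(2) by (auto simp: nonexp_on_def)
qed

section \<open>Subgradients and gradients of convex functions\<close>

text \<open>For a regular subgradient, convexity along the segment from \<open>z\<close> to
  \<open>y\<close> turns the local inequality near \<open>z\<close> into one at \<open>y\<close>.
  The limiting case follows by passing to the limit along the defining sequences, where the function
  values converge too.\<close>

lemma convex_limiting_subdiff_global:
  fixes phi :: "'a::real_inner \<Rightarrow> ereal"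
  assumes conv: "ereal_convex_on UNIV phi" and v: "v \<in> limiting_subdiff phi x"
  shows "phi x + ereal (inner v (y - x)) \<le> phi y"
proof -
  have reg: "c + inner w (y - z) \<le> s"
    if w: "w \<in> regular_subdiff phi z" and c: "phi z = ereal c" and s: "phi y \<le> ereal s" for w z c s
  proof (rule field_le_epsilon)
    fix e' :: real assume e': "e' > 0"
    define n where "n = norm (y - z)"
    have n: "0 \<le> n" by (simp add: n_def)
    define e where "e = e' / (n + 1)"
    have e: "e > 0" using e' n by (simp add: e_def)
    have en: "e * n \<le> e'" using e' n by (simp add: e_def field_simps)
    obtain d where d: "d > 0" and dd: "\<And>y. norm (y - z) < d \<Longrightarrow>
        phi z + ereal (inner w (y - z) - e * norm (y - z)) \<le> phi y"
      using w e unfolding regular_subdiff_def by (auto split: if_splits)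
    \<comment> \<open>The fraction of the segment that stays within distance \<open>d\<close> of
      \<open>z\<close>; \<open>n + 1\<close> in place of \<open>n\<close> covers
      \<open>y = z\<close>.\<close>
    define t where "t = min 1 (d / (2 * (n + 1)))"
    have t: "0 < t" "t \<le> 1" using d n by (auto simp: t_def)
    have tle: "t \<le> d / (2 * (n + 1))" by (simp add: t_def)
    have "t * n \<le> t * (n + 1)" using t by simp
    also have "\<dots> \<le> d / (2 * (n + 1)) * (n + 1)" using tle n by (intro mult_right_mono) auto
    also have "\<dots> = d / 2" using n by (simp add: field_simps)
    finally have tn: "t * n < d" using d by simp
    have "(z, c) \<in> {(x, r). x \<in> UNIV \<and> phi x \<le> ereal r}" "(y, s) \<in> {(x, r). x \<in> UNIV \<and> phi x \<le> ereal r}"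
      using c s by auto
    then have "(1 - t) *\<^sub>R (z, c) + t *\<^sub>R (y, s) \<in> {(x, r). x \<in> UNIV \<and> phi x \<le> ereal r}"
      using conv t unfolding ereal_convex_on_def by (intro convexD_alt) auto
    then have up: "phi ((1 - t) *\<^sub>R z + t *\<^sub>R y) \<le> ereal ((1 - t) * c + t * s)" by simp
    have pt: "(1 - t) *\<^sub>R z + t *\<^sub>R y - z = t *\<^sub>R (y - z)" by (simp add: algebra_simps)
    have lo: "phi z + ereal (inner w (t *\<^sub>R (y - z)) - e * (t * n)) \<le> phi ((1 - t) *\<^sub>R z + t *\<^sub>R y)"
      using dd[of "(1 - t) *\<^sub>R z + t *\<^sub>R y"] tn t unfolding pt by (simp add: n_def)
    then have "ereal (c + (t * inner w (y - z) - e * (t * n))) \<le> ereal ((1 - t) * c + t * s)"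
      using order_trans[OF lo up] c by simp
    then have "t * (c + inner w (y - z)) \<le> t * (s + e * n)" by (simp add: algebra_simps)
    then have "c + inner w (y - z) \<le> s + e * n" using t by simp
    then show "c + inner w (y - z) \<le> s + e'" using en by simp
  qed
  obtain c where c: "phi x = ereal c" using v by (rule limiting_subdiff_finite)
  obtain X V where XV: "X \<longlonglongrightarrow> x" "(\<lambda>k. phi (X k)) \<longlonglongrightarrow> phi x" "V \<longlonglongrightarrow> v"
    "\<And>k. V k \<in> regular_subdiff phi (X k)"
    using v by (auto simp: limiting_subdiff_def split: if_splits)
  define C where "C k = real_of_ereal (phi (X k))" for k
  have C: "phi (X k) = ereal (C k)" for k
    using XV(4)[of k] by (cases "phi (X k)") (auto simp: C_def regular_subdiff_def)
  have "C \<longlonglongrightarrow> c" using XV(2) unfolding C c by simp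
  then have lim: "(\<lambda>k. C k + inner (V k) (y - X k)) \<longlonglongrightarrow> c + inner v (y - x)"
    using XV by (intro tendsto_intros)
  have *: "ereal (c + inner v (y - x)) \<le> ereal s" if s: "phi y \<le> ereal s" for s
    using LIMSEQ_le_const2[OF lim, of s] reg[OF XV(4) C s] by simp
  show ?thesis
  proof (cases "phi y")
    \<comment> \<open>The value \<open>-\<infinity>\<close> has every real as an upper bound, so
      \<open>*\<close> can be applied to a bound that contradicts its own conclusion.\<close>
    case MInf
    then have "phi y \<le> ereal (c + inner v (y - x) - 1)" by simp
    from *[OF this] show ?thesis by simp
  qed (use * c in auto)
qed

lemma convex_limiting_subdiff_monotone:
  fixes phi :: "'a::real_inner \<Rightarrow> ereal"
  assumes conv: "ereal_convex_on UNIV phi"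
    and v: "v \<in> limiting_subdiff phi x" and w: "w \<in> limiting_subdiff phi y"
  shows "0 \<le> inner (x - y) (v - w)"
proof -
  obtain c where c: "phi x = ereal c" using v by (rule limiting_subdiff_finite)
  obtain d where d: "phi y = ereal d" using w by (rule limiting_subdiff_finite)
  show ?thesis
    using convex_limiting_subdiff_global[OF conv v, of y] convex_limiting_subdiff_global[OF conv w, of x] c d
    by (simp add: inner_simps inner_commute)
qed

text \<open>Along a segment the derivative of \<open>E\<close> is
  \<open>inner (G (l s)) (y - x)\<close>, which monotonicity of \<open>G\<close> makes nondecreasing
  in \<open>s\<close>; the one-dimensional criterion then applies.\<close>

lemma convex_on_of_monotone_gradient:
  fixes E :: "'a::real_inner \<Rightarrow> real"
  assumes U: "convex U"
    and deriv: "\<And>x. x \<in> U \<Longrightarrow> (E has_derivative (\<lambda>h. inner (G x) h)) (at x)"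
    and mono: "\<And>x y. x \<in> U \<Longrightarrow> y \<in> U \<Longrightarrow> 0 \<le> inner (x - y) (G x - G y)"
  shows "convex_on U E"
proof (rule convex_onI[OF _ U])
  fix t :: real and x y assume t: "0 < t" "t < 1" and xy: "x \<in> U" "y \<in> U"
  define l where "l s = x + s *\<^sub>R (y - x)" for s :: real
  have lU: "l s \<in> U" if "0 \<le> s" "s \<le> 1" for s
    using convexD_alt[OF U xy that] by (simp add: l_def algebra_simps)
  have "convex_on {0..1} (\<lambda>s. E (l s))"
  proof (rule convex_on_realI[where f' = "\<lambda>s. inner (G (l s)) (y - x)"])
    fix s :: real assume s: "s \<in> {0..1}"
    have "(l has_derivative (\<lambda>h. h *\<^sub>R (y - x))) (at s)"
      unfolding l_def by (auto intro!: derivative_eq_intros)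
    moreover have "(E has_derivative (\<lambda>h. inner (G (l s)) h)) (at (l s))"
      using s by (intro deriv lU) auto
    ultimately have "((\<lambda>s. E (l s)) has_derivative (\<lambda>h. inner (G (l s)) (h *\<^sub>R (y - x)))) (at s)"
      by (rule has_derivative_compose)
    moreover have "(\<lambda>h. inner (G (l s)) (h *\<^sub>R (y - x))) = (*) (inner (G (l s)) (y - x))"
      by (simp add: fun_eq_iff)
    ultimately show "((\<lambda>s. E (l s)) has_real_derivative inner (G (l s)) (y - x)) (at s)"
      by (simp only: has_field_derivative_def)
  next
    fix s s' :: real assume s: "s \<in> {0..1}" "s' \<in> {0..1}" "s \<le> s'"
    show "inner (G (l s)) (y - x) \<le> inner (G (l s')) (y - x)"
    proof (cases "s = s'")
      case False
      have "0 \<le> inner (l s' - l s) (G (l s') - G (l s))" using s by (intro mono lU) auto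
      also have "l s' - l s = (s' - s) *\<^sub>R (y - x)" by (simp add: l_def algebra_simps)
      finally have "0 \<le> (s' - s) * inner (y - x) (G (l s') - G (l s))" by simp
      then have "0 \<le> inner (y - x) (G (l s') - G (l s))" using s False by (simp add: zero_le_mult_iff)
      then show ?thesis by (simp add: inner_diff_right inner_commute)
    qed simp
  qed simp
  from convex_onD[OF this, of t 0 1] t
  have "E (l t) \<le> (1 - t) * E (l 0) + t * E (l 1)" by simp
  then show "E ((1 - t) *\<^sub>R x + t *\<^sub>R y) \<le> (1 - t) * E x + t * E y"
    by (simp add: l_def algebra_simps)
qed

text \<open>Step from \<open>u\<close> slightly away from \<open>w\<close>, to
  \<open>z = u - t *\<^sub>R (w - u)\<close>. Convexity bounds \<open>E u\<close> by
  \<open>E z\<close> and \<open>E w\<close>, and the upper bound at \<open>z\<close> has the right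
  slope up to an error of order \<open>t\<^sup>2\<close>, which disappears after division by
  \<open>t\<close>.\<close>

lemma convex_subgradient_of_quadratic_upper_bound:
  fixes E :: "'a::real_inner \<Rightarrow> real"
  assumes U: "open U" "u \<in> U" "w \<in> U" and conv: "convex_on U E"
    and upper: "\<And>z. E z \<le> E u + inner g (z - u) + K * (norm (z - u))\<^sup>2" and K: "0 \<le> K"
  shows "E u + inner g (w - u) \<le> E w"
proof (rule field_le_epsilon)
  fix e :: real assume e: "0 < e"
  define n where "n = norm (w - u)"
  obtain d where d: "d > 0" "ball u d \<subseteq> U" using U open_contains_ball by blast
  \<comment> \<open>The first bound keeps \<open>z\<close> inside \<open>U\<close>; the second keeps
    the error left after division by \<open>t\<close> below \<open>e\<close>.\<close>
  define t where "t = min (d / (2 * (n + 1))) (e / (K * n\<^sup>2 + 1))"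
  have n: "0 \<le> n" by (simp add: n_def)
  have q: "0 < K * n\<^sup>2 + 1" using K by (simp add: add_nonneg_pos)
  have t: "0 < t" using d e n q by (simp add: t_def)
  have "t * (n + 1) \<le> d / (2 * (n + 1)) * (n + 1)" using n by (intro mult_right_mono) (auto simp: t_def)
  also have "\<dots> = d / 2" using n by (simp add: field_simps)
  finally have tn: "t * n < d" using d t by (simp add: algebra_simps)
  have "t * (K * n\<^sup>2 + 1) \<le> e / (K * n\<^sup>2 + 1) * (K * n\<^sup>2 + 1)"
    using q by (intro mult_right_mono) (auto simp: t_def)
  also have "\<dots> = e" using q by simp
  finally have tK: "t * (K * n\<^sup>2) \<le> e" using t by (simp only: distrib_left)
  define z where "z = u - t *\<^sub>R (w - u)"
  have z: "z - u = - (t *\<^sub>R (w - u))" by (simp add: z_def)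
  have "z \<in> U" using d tn t by (auto simp: z_def dist_norm n_def subset_iff)
  have a: "1 - t / (1 + t) = 1 / (1 + t)" using t by (simp add: field_simps)
  have "(1 - t / (1 + t)) *\<^sub>R z + (t / (1 + t)) *\<^sub>R w = u"
  proof -
    have "(1 + t) *\<^sub>R ((1 / (1 + t)) *\<^sub>R z + (t / (1 + t)) *\<^sub>R w) = z + t *\<^sub>R w"
      using t by (simp add: scaleR_add_right)
    also have "\<dots> = (1 + t) *\<^sub>R u" by (simp add: z_def algebra_simps)
    finally show ?thesis using t unfolding a by simp
  qed
  with convex_onD[OF conv, of "t / (1 + t)" z w] \<open>z \<in> U\<close> U t
  have "E u \<le> (1 - t / (1 + t)) * E z + t / (1 + t) * E w" by simp
  also have "\<dots> = (E z + t * E w) / (1 + t)" unfolding a by (simp add: add_divide_distrib)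
  finally have "(1 + t) * E u \<le> E z + t * E w" using t by (simp add: field_simps)
  also have "E z \<le> E u - t * inner g (w - u) + K * (t * n)\<^sup>2"
    using upper[of z] t unfolding z by (simp add: n_def)
  finally have "t * (E u + inner g (w - u)) \<le> t * (E w + t * (K * n\<^sup>2))"
    by (simp add: algebra_simps power2_eq_square)
  then have "E u + inner g (w - u) \<le> E w + t * (K * n\<^sup>2)" using t by simp
  then show "E u + inner g (w - u) \<le> E w + e" using tK by simp
qed

text \<open>The difference \<open>?D\<close> between \<open>E\<close> and the quadratic (without its
  constant term) is maximal at \<open>u\<close>, so its derivative there is zero.\<close>

lemma gradient_unique_of_quadratic_upper_bound:
  fixes E :: "'a::real_inner \<Rightarrow> real"
  assumes deriv: "(E has_derivative (\<lambda>h. inner G h)) (at u)"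
    and upper: "\<And>z. E z \<le> E u + inner g (z - u) + K * (norm (z - u))\<^sup>2"
  shows "G = g"
proof -
  let ?D = "\<lambda>z. E z - (inner g (z - u) + K * inner (z - u) (z - u))"
  have "(?D has_derivative (\<lambda>h. inner G h - inner g h)) (at u)"
    using deriv by (auto intro!: derivative_eq_intros simp: fun_eq_iff)
  moreover have "\<forall>y\<in>UNIV. ?D y \<le> ?D u"
    using upper by (auto simp: power2_norm_eq_inner algebra_simps)
  ultimately have "(\<lambda>h. inner G h - inner g h) = (\<lambda>h. 0)"
    using differential_zero_maxmin[of u UNIV ?D "\<lambda>h. inner G h - inner g h"] by blast
  then have "inner G (G - g) - inner g (G - g) = 0" by meson
  then have "inner (G - g) (G - g) = 0" by (simp add: inner_diff_left)
  then show ?thesis by simp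
qed

text \<open>A map and its residual are firmly nonexpansive together. For the proximal mapping the
  residual is \<open>lam\<close> times the gradient of the envelope, which ties cocoercivity to firm
  nonexpansiveness.\<close>

lemma firmly_nonexp_residual_iff:
  fixes x y p q :: "'a::real_inner"
  shows "(norm ((x - p) - (y - q)))\<^sup>2 \<le> inner (x - y) ((x - p) - (y - q))
    \<longleftrightarrow> (norm (p - q))\<^sup>2 \<le> inner (x - y) (p - q)"
  by (simp add: power2_norm_eq_inner inner_diff_left inner_diff_right inner_commute) argo

lemma firmly_nonexp_imp_nonexp:
  assumes "firmly_nonexp_on U T"
  shows "nonexp_on U T"
  unfolding nonexp_on_def
proof (intro ballI)
  fix x y p q assume "x \<in> U" "y \<in> U" "p \<in> T x" "q \<in> T y"
  then have "(norm (p - q))\<^sup>2 \<le> inner (x - y) (p - q)"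
    using assms unfolding firmly_nonexp_on_def by blast
  also have "\<dots> \<le> norm (x - y) * norm (p - q)" by (rule norm_cauchy_schwarz)
  finally show "norm (p - q) \<le> norm (x - y)"
    by (cases "norm (p - q) = 0") (auto simp: power2_eq_square)
qed

section \<open>Existence and localization of proximal points under a global quadratic
  minorant\<close>

text \<open>The minorant touches \<open>f\<close> at \<open>xb\<close>. By
  \<open>lam * r < 1\<close> the proximal penalty outweighs its concave part, so the proximal
  objective grows quadratically.\<close>

locale quadratically_minorized =
  fixes f :: "'a::euclidean_space \<Rightarrow> ereal" and xb vb :: 'a and fb r lam :: real
  assumes lsc: "lsc_fun f" and f_xb: "f xb = ereal fb"
    and minorant: "ereal (fb + inner vb (y - xb) - r / 2 * (norm (y - xb))\<^sup>2) \<le> f y"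
    and lam_pos: "0 < lam" and lam_r: "lam * r < 1"
begin

abbreviation "P \<equiv> prox_map lam f"
abbreviation "ub \<equiv> xb + lam *\<^sub>R vb"
abbreviation "E u \<equiv> real_of_ereal (moreau_env lam f u)"

lemma proper: "proper_fun f"
proof -
  have "f y \<noteq> -\<infinity>" for y using minorant[of y] by (cases "f y") auto
  then show ?thesis using f_xb unfolding proper_fun_def by (metis PInfty_neq_ereal(1))
qed

text \<open>The quadratic coefficient that remains when the proximal penalty is added to the
  minorant.\<close>

definition gap :: real where "gap = (1 / lam - r) / 2"

lemma gap_pos: "0 < gap"
  using lam_pos lam_r by (simp add: gap_def field_simps)

text \<open>Coercivity of the proximal objective, expanded about \<open>xb\<close> rather than
  \<open>u\<close> so that it is uniform over all centres \<open>u\<close> within \<open>M\<close>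
  of \<open>xb\<close>.\<close>

lemma growth:
  assumes M: "norm (u - xb) \<le> M"
  shows "ereal (fb + gap * (norm (y - xb))\<^sup>2 - (norm vb + M / lam) * norm (y - xb))
     \<le> f y + ereal (1 / (2 * lam) * (norm (y - u))\<^sup>2)"
proof -
  define d where "d = norm (y - xb)"
  have "- (norm vb * d) \<le> inner vb (y - xb)"
    using Cauchy_Schwarz_ineq2[of vb "y - xb"] by (simp add: d_def)
  moreover have "inner (y - xb) (u - xb) \<le> d * M"
  proof -
    have "inner (y - xb) (u - xb) \<le> d * norm (u - xb)"
      using norm_cauchy_schwarz[of "y - xb" "u - xb"] by (simp add: d_def)
    also have "\<dots> \<le> d * M" using M by (intro mult_left_mono) (auto simp: d_def)
    finally show ?thesis .
  qed
  moreover have "(norm (y - u))\<^sup>2 = d\<^sup>2 - 2 * inner (y - xb) (u - xb) + (norm (u - xb))\<^sup>2"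
    by (simp add: d_def power2_norm_eq_inner inner_diff_left inner_diff_right inner_commute)
  ultimately have "d\<^sup>2 - 2 * (d * M) \<le> (norm (y - u))\<^sup>2"
    by (smt (verit) zero_le_power2)
  then have "1 / (2 * lam) * (d\<^sup>2 - 2 * (d * M)) \<le> 1 / (2 * lam) * (norm (y - u))\<^sup>2"
    using lam_pos by (intro mult_left_mono) auto
  moreover have "1 / (2 * lam) * (d\<^sup>2 - 2 * (d * M)) = gap * d\<^sup>2 + r / 2 * d\<^sup>2 - M / lam * d"
    using lam_pos by (simp add: gap_def field_simps)
  ultimately have "fb + gap * d\<^sup>2 - (norm vb + M / lam) * d
      \<le> fb + inner vb (y - xb) - r / 2 * d\<^sup>2 + 1 / (2 * lam) * (norm (y - u))\<^sup>2"
    using \<open>- (norm vb * d) \<le> inner vb (y - xb)\<close> unfolding distrib_right by linarith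
  then have "ereal (fb + gap * d\<^sup>2 - (norm vb + M / lam) * d)
      \<le> ereal (fb + inner vb (y - xb) - r / 2 * d\<^sup>2) + ereal (1 / (2 * lam) * (norm (y - u))\<^sup>2)"
    by simp
  also have "\<dots> \<le> f y + ereal (1 / (2 * lam) * (norm (y - u))\<^sup>2)"
    unfolding d_def by (intro add_right_mono minorant)
  finally show ?thesis by (simp add: d_def)
qed

text \<open>Here \<open>C k\<close> bounds the proximal objective with centre \<open>U k\<close> at
  \<open>X k\<close>. Growth confines the points to a bounded set, and lower semicontinuity carries
  the bound to the limit. Constant centres yield existence of proximal points, moving ones yield
  localization.\<close>

lemma approximate_minimizers_subconverge:
  fixes U X :: "nat \<Rightarrow> 'a" and C :: "nat \<Rightarrow> real"
  assumes U: "U \<longlonglongrightarrow> u" and C: "C \<longlonglongrightarrow> c"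
    and le: "\<And>k. f (X k) \<le> ereal (C k - 1 / (2 * lam) * (norm (X k - U k))\<^sup>2)"
  obtains p s where "strict_mono s" "(X \<circ> s) \<longlonglongrightarrow> p"
    "f p \<le> ereal (c - 1 / (2 * lam) * (norm (p - u))\<^sup>2)"
proof -
  have "Bseq (\<lambda>k. U k - xb)"
    using U by (intro convergent_imp_Bseq convergentI[of _ "u - xb"] tendsto_intros)
  then obtain M where M: "M > 0" "\<And>k. norm (U k - xb) \<le> M" by (auto simp: Bseq_def)
  have "Bseq (\<lambda>k. C k - fb)"
    using C by (intro convergent_imp_Bseq convergentI[of _ "c - fb"] tendsto_intros)
  then obtain B where B: "B > 0" "\<And>k. norm (C k - fb) \<le> B" by (auto simp: Bseq_def)
  define b where "b = norm vb + M / lam"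
  \<comment> \<open>When the distance \<open>d\<close> exceeds 1, the constant \<open>B\<close> is
    at most \<open>B * d\<close>, so \<open>gap * d\<^sup>2 \<le> B + b * d\<close> can be divided
    by \<open>d\<close>.\<close>
  have "norm (X k - xb) \<le> max 1 ((B + b) / gap)" for k
  proof (cases "norm (X k - xb) \<le> 1")
    case False
    define d where "d = norm (X k - xb)"
    have d: "d > 1" using False by (simp add: d_def)
    have "f (X k) + ereal (1 / (2 * lam) * (norm (X k - U k))\<^sup>2) \<le> ereal (C k)"
      using add_right_mono[OF le[of k], of "ereal (1 / (2 * lam) * (norm (X k - U k))\<^sup>2)"] by simp
    with growth[OF M(2)[of k], of "X k"]
    have "ereal (fb + gap * d\<^sup>2 - b * d) \<le> ereal (C k)"
      unfolding b_def d_def by (rule order_trans)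
    then have "gap * d\<^sup>2 \<le> B + b * d" using B(2)[of k] by simp
    also have "B \<le> B * d" using B d by simp
    finally have "(gap * d) * d \<le> (B + b) * d" by (simp add: algebra_simps power2_eq_square)
    then have "gap * d \<le> B + b" using d by simp
    then have "d \<le> (B + b) / gap" using gap_pos by (simp add: field_simps)
    then show ?thesis by (simp add: d_def)
  qed simp
  then have "bounded (range (\<lambda>k. X k - xb))" by (intro boundedI) blast
  then obtain l s where s: "strict_mono s" and l: "((\<lambda>k. X k - xb) \<circ> s) \<longlonglongrightarrow> l"
    using bounded_imp_convergent_subsequence by blast
  have "(\<lambda>k. ((\<lambda>k. X k - xb) \<circ> s) k + xb) \<longlonglongrightarrow> l + xb" using l by (intro tendsto_intros)
  then have X: "(X \<circ> s) \<longlonglongrightarrow> l + xb" by (simp add: o_def)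
  have Us: "(\<lambda>k. U (s k)) \<longlonglongrightarrow> u" and Cs: "(\<lambda>k. C (s k)) \<longlonglongrightarrow> c"
    using LIMSEQ_subseq_LIMSEQ[OF U s] LIMSEQ_subseq_LIMSEQ[OF C s] by (simp_all add: o_def)
  have lim: "(\<lambda>k. ereal (C (s k) - 1 / (2 * lam) * (norm (X (s k) - U (s k)))\<^sup>2))
     \<longlonglongrightarrow> ereal (c - 1 / (2 * lam) * (norm (l + xb - u))\<^sup>2)"
    using X Us Cs unfolding o_def by (intro tendsto_intros)
  have "f (l + xb) \<le> liminf (\<lambda>k. f ((X \<circ> s) k))"
    using lsc X unfolding lsc_fun_def by blast
  also have "\<dots> \<le> liminf (\<lambda>k. ereal (C (s k) - 1 / (2 * lam) * (norm (X (s k) - U (s k)))\<^sup>2))"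
    using le by (intro Liminf_mono) simp
  also have "\<dots> = ereal (c - 1 / (2 * lam) * (norm (l + xb - u))\<^sup>2)"
    by (rule lim_imp_Liminf[OF _ lim]) simp
  finally show ?thesis using that s X by blast
qed

lemma moreau_env_le: "moreau_env lam f u \<le> f y + ereal (1 / (2 * lam) * (norm (y - u))\<^sup>2)"
  unfolding moreau_env_def by (rule INF_lower) simp

text \<open>The lower bound is the minimum of the parabola supplied by \<open>growth\<close>, the
  upper bound the objective at \<open>xb\<close>. Hence \<open>real_of_ereal\<close> in
  \<open>E\<close> loses no information.\<close>

lemma moreau_env_finite: "moreau_env lam f u = ereal (E u)"
proof -
  define b where "b = norm vb + norm (u - xb) / lam"
  have "ereal (fb - b\<^sup>2 / (4 * gap)) \<le> moreau_env lam f u"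
    unfolding moreau_env_def
  proof (rule INF_greatest)
    fix y
    define d where "d = norm (y - xb)"
    have "0 \<le> gap * (d - b / (2 * gap))\<^sup>2" using gap_pos by simp
    also have "\<dots> = gap * d\<^sup>2 - b * d + b\<^sup>2 / (4 * gap)"
      using gap_pos by (simp add: power2_eq_square field_simps)
    finally have "ereal (fb - b\<^sup>2 / (4 * gap)) \<le> ereal (fb + gap * d\<^sup>2 - b * d)" by simp
    also have "\<dots> \<le> f y + ereal (1 / (2 * lam) * (norm (y - u))\<^sup>2)"
      unfolding b_def d_def by (rule growth) simp
    finally show "ereal (fb - b\<^sup>2 / (4 * gap)) \<le> f y + ereal (1 / (2 * lam) * (norm (y - u))\<^sup>2)" .
  qed
  moreover have "moreau_env lam f u \<le> ereal (fb + 1 / (2 * lam) * (norm (xb - u))\<^sup>2)"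
    using moreau_env_le[of u xb] f_xb by simp
  ultimately show ?thesis by (cases "moreau_env lam f u") auto
qed

lemma prox_nonempty: "P u \<noteq> {}"
proof -
  define c where "c = E u"
  \<comment> \<open>Direct method: a minimizing sequence for the fixed centre
    \<open>u\<close>.\<close>
  have "\<exists>y. f y + ereal (1 / (2 * lam) * (norm (y - u))\<^sup>2) < ereal (c + inverse (real (Suc n)))" for n
  proof -
    have "moreau_env lam f u < ereal (c + inverse (real (Suc n)))"
      by (subst moreau_env_finite) (simp add: c_def)
    then show ?thesis unfolding moreau_env_def by (simp add: INF_less_iff)
  qed
  then obtain X where X: "\<And>n. f (X n) + ereal (1 / (2 * lam) * (norm (X n - u))\<^sup>2)
      < ereal (c + inverse (real (Suc n)))" by metis
  have "f (X n) \<le> ereal (c + inverse (real (Suc n)) - 1 / (2 * lam) * (norm (X n - u))\<^sup>2)" for n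
    using X[of n] by (cases "f (X n)") auto
  then obtain p where p: "f p \<le> ereal (c - 1 / (2 * lam) * (norm (p - u))\<^sup>2)"
    using approximate_minimizers_subconverge[OF tendsto_const LIMSEQ_inverse_real_of_nat_add] by metis
  have "f p + ereal (1 / (2 * lam) * (norm (p - u))\<^sup>2) \<le> ereal c"
    using p by (cases "f p") auto
  also have "ereal c = moreau_env lam f u" unfolding c_def by (rule moreau_env_finite[symmetric])
  finally have "p \<in> P u" unfolding prox_map_def using moreau_env_le[of u] order_trans by blast
  then show ?thesis by blast
qed

text \<open>At the centre \<open>ub\<close>, completing the square cancels the linear term of the
  minorant and leaves \<open>gap * (norm (p - xb))\<^sup>2 \<le> 0\<close>.\<close>

lemma near_minimizer_unique:
  assumes p: "f p \<le> ereal (fb + 1 / (2 * lam) * (norm (xb - ub))\<^sup>2 - 1 / (2 * lam) * (norm (p - ub))\<^sup>2)"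
  shows "p = xb"
proof -
  have id: "1 / (2 * lam) * (norm (p - ub))\<^sup>2
      = 1 / (2 * lam) * (norm (p - xb))\<^sup>2 - inner vb (p - xb) + 1 / (2 * lam) * (norm (xb - ub))\<^sup>2"
    using lam_pos unfolding power2_norm_eq_inner
    by (simp add: inner_diff_left inner_diff_right inner_add_left inner_add_right inner_commute field_simps)
  have "fb + inner vb (p - xb) - r / 2 * (norm (p - xb))\<^sup>2
    \<le> fb + 1 / (2 * lam) * (norm (xb - ub))\<^sup>2 - 1 / (2 * lam) * (norm (p - ub))\<^sup>2"
    using order_trans[OF minorant p] by simp
  then have "1 / (2 * lam) * (norm (p - xb))\<^sup>2 - r / 2 * (norm (p - xb))\<^sup>2 \<le> 0" unfolding id by simp
  then have "gap * (norm (p - xb))\<^sup>2 \<le> 0" by (simp add: gap_def field_simps)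
  then show ?thesis using gap_pos by (simp add: mult_le_0_iff)
qed

lemma prox_upper:
  assumes "p \<in> P u"
  shows "f p \<le> ereal (fb + 1 / (2 * lam) * (norm (xb - u))\<^sup>2 - 1 / (2 * lam) * (norm (p - u))\<^sup>2)"
proof -
  have "f p + ereal (1 / (2 * lam) * (norm (p - u))\<^sup>2) \<le> f xb + ereal (1 / (2 * lam) * (norm (xb - u))\<^sup>2)"
    using assms by (simp add: prox_map_def)
  then show ?thesis by (cases "f p") (auto simp: f_xb)
qed

lemma prox_at_ub: "P ub = {xb}"
  using prox_nonempty[of ub] near_minimizer_unique[OF prox_upper] by blast

text \<open>By contradiction: bad proximal points for centres tending to \<open>ub\<close> have a
  subsequence converging to a minimizer at \<open>ub\<close>, which can only be \<open>xb\<close>.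
  Along it the residuals tend to \<open>(ub - xb) / lam = vb\<close>.\<close>

lemma prox_localization:
  assumes "0 < \<eta>"
  obtains d where "d > 0" and "\<And>u p. norm (u - ub) < d \<Longrightarrow> p \<in> P u \<Longrightarrow>
     norm (p - xb) < \<eta> \<and> norm ((1 / lam) *\<^sub>R (u - p) - vb) < \<eta> \<and> f p < f xb + ereal \<eta>"
proof -
  let ?good = "\<lambda>u p. norm (p - xb) < \<eta> \<and> norm ((1 / lam) *\<^sub>R (u - p) - vb) < \<eta> \<and> f p < f xb + ereal \<eta>"
  have "\<exists>d>0. \<forall>u p. norm (u - ub) < d \<longrightarrow> p \<in> P u \<longrightarrow> ?good u p"
  proof (rule ccontr)
    assume "\<not> ?thesis"
    then have "\<exists>u p. norm (u - ub) < inverse (real (Suc n)) \<and> p \<in> P u \<and> \<not> ?good u p" for n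
      by (meson inverse_positive_iff_positive of_nat_0_less_iff zero_less_Suc)
    then obtain U X where UX: "\<And>n. norm (U n - ub) < inverse (real (Suc n))"
      "\<And>n. X n \<in> P (U n)" "\<And>n. \<not> ?good (U n) (X n)" by metis
    have "(\<lambda>n. U n - ub) \<longlonglongrightarrow> 0"
      using UX(1) by (intro tendsto_norm_zero_cancel[OF tendsto_sandwich[OF _ _ tendsto_const LIMSEQ_inverse_real_of_nat]])
         (auto intro!: always_eventually less_imp_le)
    then have U: "U \<longlonglongrightarrow> ub" by (simp add: LIM_zero_iff)
    have C: "(\<lambda>k. fb + 1 / (2 * lam) * (norm (xb - U k))\<^sup>2) \<longlonglongrightarrow> fb + 1 / (2 * lam) * (norm (xb - ub))\<^sup>2"
      using U by (intro tendsto_intros)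
    obtain p s where s: "strict_mono s" "(X \<circ> s) \<longlonglongrightarrow> p"
      "f p \<le> ereal (fb + 1 / (2 * lam) * (norm (xb - ub))\<^sup>2 - 1 / (2 * lam) * (norm (p - ub))\<^sup>2)"
      using approximate_minimizers_subconverge[OF U C prox_upper[OF UX(2)]] by blast
    have "p = xb" using s(3) by (rule near_minimizer_unique)
    with s have Xs: "(\<lambda>k. X (s k)) \<longlonglongrightarrow> xb" by (simp add: o_def)
    have Us: "(\<lambda>k. U (s k)) \<longlonglongrightarrow> ub" using LIMSEQ_subseq_LIMSEQ[OF U s(1)] by (simp add: o_def)
    have "(\<lambda>k. norm (X (s k) - xb)) \<longlonglongrightarrow> norm (xb - xb)" using Xs by (intro tendsto_intros)
    then have e1: "\<forall>\<^sub>F k in sequentially. norm (X (s k) - xb) < \<eta>"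
      by (rule order_tendstoD) (use assms in simp)
    have "(\<lambda>k. norm ((1 / lam) *\<^sub>R (U (s k) - X (s k)) - vb)) \<longlonglongrightarrow> norm ((1 / lam) *\<^sub>R (ub - xb) - vb)"
      using Xs Us by (intro tendsto_intros)
    then have e2: "\<forall>\<^sub>F k in sequentially. norm ((1 / lam) *\<^sub>R (U (s k) - X (s k)) - vb) < \<eta>"
      by (rule order_tendstoD) (use assms lam_pos in simp)
    \<comment> \<open>Control of the values of \<open>f\<close> comes from the comparison with
      \<open>xb\<close> in \<open>prox_upper\<close>, whose right-hand side tends to
      \<open>fb\<close>.\<close>
    have "(\<lambda>k. fb + 1 / (2 * lam) * (norm (xb - U (s k)))\<^sup>2 - 1 / (2 * lam) * (norm (X (s k) - U (s k)))\<^sup>2)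
       \<longlonglongrightarrow> fb + 1 / (2 * lam) * (norm (xb - ub))\<^sup>2 - 1 / (2 * lam) * (norm (xb - ub))\<^sup>2"
      using Xs Us by (intro tendsto_intros)
    then have "\<forall>\<^sub>F k in sequentially. fb + 1 / (2 * lam) * (norm (xb - U (s k)))\<^sup>2
        - 1 / (2 * lam) * (norm (X (s k) - U (s k)))\<^sup>2 < fb + \<eta>"
      by (rule order_tendstoD) (use assms in simp)
    then have e3: "\<forall>\<^sub>F k in sequentially. f (X (s k)) < f xb + ereal \<eta>"
    proof eventually_elim
      case (elim k)
      show ?case using le_less_trans[OF prox_upper[OF UX(2)[of "s k"]], of "ereal (fb + \<eta>)"] elim
        by (simp add: f_xb)
    qed
    have "\<forall>\<^sub>F k in sequentially. ?good (U (s k)) (X (s k))"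
      using e1 e2 e3 by eventually_elim blast
    then show False using UX(3) by (auto simp: eventually_sequentially)
  qed
  then show ?thesis using that by blast
qed

section \<open>Differentiability and convexity of the envelope\<close>

lemma moreau_env_at_prox:
  assumes "p \<in> P u"
  shows "moreau_env lam f u = f p + ereal (1 / (2 * lam) * (norm (p - u))\<^sup>2)"
proof (rule antisym)
  show "f p + ereal (1 / (2 * lam) * (norm (p - u))\<^sup>2) \<le> moreau_env lam f u"
    unfolding moreau_env_def using assms by (intro INF_greatest) (auto simp: prox_map_def)
qed (rule moreau_env_le)

text \<open>The proximal point \<open>p\<close> of \<open>u\<close> serves as a competitor in the
  infimum at \<open>w\<close>.\<close>

lemma moreau_env_quadratic_upper_bound:
  assumes p: "p \<in> P u"
  shows "E w \<le> E u + inner ((1 / lam) *\<^sub>R (u - p)) (w - u) + 1 / (2 * lam) * (norm (w - u))\<^sup>2"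
proof -
  obtain c where c: "f p = ereal c" using prox_map_finite[OF proper p] .
  have "E u = c + 1 / (2 * lam) * (norm (p - u))\<^sup>2"
    using moreau_env_at_prox[OF p] c by simp
  moreover have "E w \<le> c + 1 / (2 * lam) * (norm (p - w))\<^sup>2"
    using moreau_env_le[of w p] c by (subst (asm) moreau_env_finite) simp
  moreover have "1 / (2 * lam) * (norm (p - w))\<^sup>2 = 1 / (2 * lam) * (norm (p - u))\<^sup>2
      + inner ((1 / lam) *\<^sub>R (u - p)) (w - u) + 1 / (2 * lam) * (norm (w - u))\<^sup>2"
    using lam_pos unfolding power2_norm_eq_inner
    by (simp add: inner_diff_left inner_diff_right inner_commute field_simps)
  ultimately show ?thesis by simp
qed

text \<open>The quadratic upper bound based at \<open>x\<close> gives one side. The bound based at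
  \<open>y\<close> gives the other, once nonexpansiveness is used to compare the residuals at
  \<open>x\<close> and \<open>y\<close> in direction \<open>y - x\<close>.\<close>

lemma moreau_env_has_derivative:
  assumes ne: "nonexp_on U P" and U: "open U" and x: "x \<in> U" and p: "p \<in> P x"
  shows "((\<lambda>y. E y) has_derivative (\<lambda>h. inner ((1 / lam) *\<^sub>R (x - p)) h)) (at x)"
proof -
  let ?g = "(1 / lam) *\<^sub>R (x - p)"
  have bound: "\<bar>E y - E x - inner ?g (y - x)\<bar> \<le> 1 / (2 * lam) * (norm (y - x))\<^sup>2" if y: "y \<in> U" for y
  proof -
    obtain q where q: "q \<in> P y" using prox_nonempty by blast
    have "norm (q - p) \<le> norm (y - x)" using ne x y p q by (simp add: nonexp_on_def)
    then have "inner (q - p) (y - x) \<le> norm (y - x) * norm (y - x)"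
      using norm_cauchy_schwarz[of "q - p" "y - x"] by (smt (verit) mult_right_mono norm_ge_zero)
    also have "\<dots> = inner (y - x) (y - x)" by (simp add: dot_square_norm power2_eq_square)
    finally have "inner (x - p) (y - x) \<le> inner (y - q) (y - x)"
      by (simp add: inner_diff_left)
    then have "1 / lam * inner (x - p) (y - x) \<le> 1 / lam * inner (y - q) (y - x)"
      using lam_pos by (intro mult_left_mono) auto
    then have "inner ?g (y - x) \<le> inner ((1 / lam) *\<^sub>R (y - q)) (y - x)" by simp
    moreover have "E x \<le> E y + inner ((1 / lam) *\<^sub>R (y - q)) (x - y) + 1 / (2 * lam) * (norm (x - y))\<^sup>2"
      using q by (rule moreau_env_quadratic_upper_bound)
    moreover have "inner ((1 / lam) *\<^sub>R (y - q)) (x - y) = - inner ((1 / lam) *\<^sub>R (y - q)) (y - x)"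
      by (metis inner_minus_right minus_diff_eq)
    moreover have "E y \<le> E x + inner ?g (y - x) + 1 / (2 * lam) * (norm (y - x))\<^sup>2"
      using p by (rule moreau_env_quadratic_upper_bound)
    ultimately show ?thesis by (simp only: norm_minus_commute[of x y] abs_le_iff) linarith
  qed
  show ?thesis unfolding has_derivative_at_alt
  proof (intro conjI allI impI)
    show "bounded_linear (\<lambda>h. inner ?g h)" by (rule bounded_linear_inner_right)
    fix e :: real assume e: "0 < e"
    obtain d where d: "d > 0" "ball x d \<subseteq> U" using U x open_contains_ball by blast
    show "\<exists>d>0. \<forall>y. norm (y - x) < d \<longrightarrow> norm (E y - E x - inner ?g (y - x)) \<le> e * norm (y - x)"
    proof (intro exI[of _ "min d (e * (2 * lam))"] conjI allI impI)
      show "0 < min d (e * (2 * lam))" using d e lam_pos by simp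
      fix y assume y: "norm (y - x) < min d (e * (2 * lam))"
      then have "y \<in> U" using d by (auto simp: dist_norm norm_minus_commute subset_iff)
      have "1 / (2 * lam) * norm (y - x) \<le> e" using y lam_pos by (simp add: field_simps)
      then have "1 / (2 * lam) * norm (y - x) * norm (y - x) \<le> e * norm (y - x)"
        by (intro mult_right_mono) auto
      then show "norm (E y - E x - inner ?g (y - x)) \<le> e * norm (y - x)"
        using bound[OF \<open>y \<in> U\<close>] by (simp add: power2_eq_square)
    qed
  qed
qed

lemma nonexp_imp_gradient:
  assumes ne: "nonexp_on U P" and U: "open U"
  obtains p where "\<And>x. x \<in> U \<Longrightarrow> P x = {p x}"
    "\<And>x. x \<in> U \<Longrightarrow> ((\<lambda>y. E y) has_derivative (\<lambda>h. inner ((1 / lam) *\<^sub>R (x - p x)) h)) (at x)"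
proof -
  define p where "p x = (SOME q. q \<in> P x)" for x
  have p: "p x \<in> P x" for x using prox_nonempty[of x] unfolding p_def by (simp add: some_in_eq)
  have "q = p x" if "x \<in> U" "q \<in> P x" for x q
  proof -
    have "norm (q - p x) \<le> norm (x - x)" using ne p that unfolding nonexp_on_def by blast
    then show ?thesis by simp
  qed
  then have "P x = {p x}" if "x \<in> U" for x using p that by blast
  moreover have "((\<lambda>y. E y) has_derivative (\<lambda>h. inner ((1 / lam) *\<^sub>R (x - p x)) h)) (at x)"
    if "x \<in> U" for x by (rule moreau_env_has_derivative[OF ne U that p])
  ultimately show ?thesis using that by blast
qed

lemma ereal_convex_on_moreau_env_iff:
  "ereal_convex_on U (moreau_env lam f) \<longleftrightarrow> convex_on U (\<lambda>u. E u)"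
proof -
  have "{(x, s). x \<in> U \<and> moreau_env lam f x \<le> ereal s} = epigraph U (\<lambda>u. E u)"
    by (subst moreau_env_finite) (auto simp: epigraph_def)
  then show ?thesis by (simp add: ereal_convex_on_def convex_epigraph)
qed

text \<open>By Cauchy-Schwarz, nonexpansiveness of the proximal mapping makes its residual monotone,
  and the residual over \<open>lam\<close> is the gradient of the envelope.\<close>

lemma nonexp_imp_moreau_env_convex:
  assumes ne: "nonexp_on U P" and U: "open U" "convex U"
  shows "ereal_convex_on U (moreau_env lam f)"
proof -
  obtain p where p: "\<And>x. x \<in> U \<Longrightarrow> P x = {p x}"
    "\<And>x. x \<in> U \<Longrightarrow> ((\<lambda>y. E y) has_derivative (\<lambda>h. inner ((1 / lam) *\<^sub>R (x - p x)) h)) (at x)"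
    using nonexp_imp_gradient[OF ne U(1)] by blast
  have "convex_on U (\<lambda>u. E u)"
  proof (rule convex_on_of_monotone_gradient[OF U(2) p(2)])
    fix x y assume xy: "x \<in> U" "y \<in> U"
    have "norm (p x - p y) \<le> norm (x - y)" using ne xy p(1) by (simp add: nonexp_on_def)
    then have "norm (x - y) * norm (p x - p y) \<le> norm (x - y) * norm (x - y)"
      by (rule mult_left_mono) simp
    then have "inner (x - y) (p x - p y) \<le> inner (x - y) (x - y)"
      using norm_cauchy_schwarz[of "x - y" "p x - p y"]
      by (simp add: power2_norm_eq_inner[symmetric] power2_eq_square)
    then have "0 \<le> 1 / lam * inner (x - y) ((x - y) - (p x - p y))"
      using lam_pos by (simp add: inner_diff_right)
    also have "\<dots> = inner (x - y) ((1 / lam) *\<^sub>R ((x - y) - (p x - p y)))" by simp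
    also have "(1 / lam) *\<^sub>R ((x - y) - (p x - p y)) = (1 / lam) *\<^sub>R (x - p x) - (1 / lam) *\<^sub>R (y - p y)"
      by (simp add: algebra_simps)
    finally show "0 \<le> inner (x - y) ((1 / lam) *\<^sub>R (x - p x) - (1 / lam) *\<^sub>R (y - p y))" .
  qed
  then show ?thesis by (simp add: ereal_convex_on_moreau_env_iff)
qed

text \<open>Any gradient of the envelope must equal the residual over \<open>lam\<close>, so
  cocoercivity is a statement about residuals. Conversely, firm nonexpansiveness first supplies
  differentiability.\<close>

lemma grad_cocoercive_iff_firmly_nonexp:
  assumes U: "open U"
  shows "grad_cocoercive_on lam U (moreau_env lam f) \<longleftrightarrow> firmly_nonexp_on U P"
proof
  assume "grad_cocoercive_on lam U (moreau_env lam f)"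
  then obtain G where G: "\<And>x. x \<in> U \<Longrightarrow> ((\<lambda>y. E y) has_derivative (\<lambda>h. inner (G x) h)) (at x)"
    and co: "cocoercive_on lam U G" by (auto simp: grad_cocoercive_on_def)
  have res: "lam *\<^sub>R G x = x - p" if "x \<in> U" "p \<in> P x" for x p
    using gradient_unique_of_quadratic_upper_bound[OF G[OF that(1)] moreau_env_quadratic_upper_bound[OF that(2)]]
      lam_pos by simp
  show "firmly_nonexp_on U P" unfolding firmly_nonexp_on_def
  proof (intro ballI)
    fix x y p q assume h: "x \<in> U" "y \<in> U" "p \<in> P x" "q \<in> P y"
    have "(norm (lam *\<^sub>R G x - lam *\<^sub>R G y))\<^sup>2 \<le> inner (x - y) (lam *\<^sub>R G x - lam *\<^sub>R G y)"
      using co h by (auto simp: cocoercive_on_def firmly_nonexp_on_def)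
    then show "(norm (p - q))\<^sup>2 \<le> inner (x - y) (p - q)"
      unfolding res[OF h(1,3)] res[OF h(2,4)] firmly_nonexp_residual_iff .
  qed
next
  assume F: "firmly_nonexp_on U P"
  obtain p where p: "\<And>x. x \<in> U \<Longrightarrow> P x = {p x}"
    "\<And>x. x \<in> U \<Longrightarrow> ((\<lambda>y. E y) has_derivative (\<lambda>h. inner ((1 / lam) *\<^sub>R (x - p x)) h)) (at x)"
    using nonexp_imp_gradient[OF firmly_nonexp_imp_nonexp[OF F] U] by blast
  have "cocoercive_on lam U (\<lambda>x. (1 / lam) *\<^sub>R (x - p x))"
    using F p(1) lam_pos by (simp add: cocoercive_on_def firmly_nonexp_on_def firmly_nonexp_residual_iff)
  moreover have "\<bar>moreau_env lam f x\<bar> \<noteq> \<infinity>" for x by (subst moreau_env_finite) simp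
  ultimately show "grad_cocoercive_on lam U (moreau_env lam f)"
    unfolding grad_cocoercive_on_def using p(2)
    by (intro exI[of _ "\<lambda>x. (1 / lam) *\<^sub>R (x - p x)"] conjI ballI)
qed

section \<open>From variational convexity to the proximal mapping and back\<close>

lemma shift_near:
  assumes "norm (x - xb) < d" "norm (v - vb) < d" "(1 + lam) * d \<le> k"
  shows "norm ((x + lam *\<^sub>R v) - ub) < k"
proof -
  have "(x + lam *\<^sub>R v) - ub = (x - xb) + lam *\<^sub>R (v - vb)" by (simp add: algebra_simps)
  then have "norm ((x + lam *\<^sub>R v) - ub) \<le> norm (x - xb) + norm (lam *\<^sub>R (v - vb))"
    by (simp only: norm_triangle_ineq)
  also have "norm (lam *\<^sub>R (v - vb)) = lam * norm (v - vb)" using lam_pos by simp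
  also have "norm (x - xb) + lam * norm (v - vb) < d + lam * d" using assms lam_pos by (intro add_less_le_mono mult_left_mono) auto
  also have "\<dots> \<le> k" using assms by (simp add: algebra_simps)
  finally show ?thesis .
qed

lemma prox_imp_limiting_subdiff:
  assumes "p \<in> P u"
  shows "(1 / lam) *\<^sub>R (u - p) \<in> limiting_subdiff f p"
proof -
  have "(1 / lam) *\<^sub>R (u - p) \<in> prox_subdiff_level lam f p"
    using assms lam_pos by (simp add: prox_subdiff_level_iff_prox_map[OF proper lam_pos])
  then show ?thesis using prox_subdiff_level_subset_limiting[OF lam_pos] by blast
qed

text \<open>For centres near \<open>ub\<close>, localization puts the pairs
  \<open>(p, (u - p) / lam)\<close> into the part of the graph shared with the convex function
  \<open>phi\<close>, where subgradients are monotone.\<close>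

lemma variationally_convex_imp_firmly_nonexp:
  assumes "variationally_convex_at f xb vb"
  obtains d where "0 < d" "firmly_nonexp_on (ball ub d) P"
proof -
  obtain U V phi e where xU: "xb \<in> interior U" and vV: "vb \<in> interior V"
    and phi: "ereal_convex_on UNIV phi" and e: "e > 0"
    and graph: "\<And>x v. x \<in> U \<Longrightarrow> f x < f xb + ereal e \<Longrightarrow> v \<in> V \<Longrightarrow> v \<in> limiting_subdiff f x
       \<Longrightarrow> v \<in> limiting_subdiff phi x"
    using assms unfolding variationally_convex_at_def by metis
  obtain d1 where d1: "d1 > 0" "ball xb d1 \<subseteq> U" using xU by (auto simp: mem_interior)
  obtain d2 where d2: "d2 > 0" "ball vb d2 \<subseteq> V" using vV by (auto simp: mem_interior)
  define \<eta> where "\<eta> = min e (min d1 d2)"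
  have "\<eta> > 0" using e d1 d2 by (simp add: \<eta>_def)
  then obtain d where d: "d > 0" and loc: "\<And>u p. norm (u - ub) < d \<Longrightarrow> p \<in> P u \<Longrightarrow>
     norm (p - xb) < \<eta> \<and> norm ((1 / lam) *\<^sub>R (u - p) - vb) < \<eta> \<and> f p < f xb + ereal \<eta>"
    using prox_localization by blast
  have sub: "(1 / lam) *\<^sub>R (u - p) \<in> limiting_subdiff phi p" if "u \<in> ball ub d" "p \<in> P u" for u p
  proof (rule graph)
    have n: "norm (p - xb) < \<eta>" "norm ((1 / lam) *\<^sub>R (u - p) - vb) < \<eta>" "f p < f xb + ereal \<eta>"
      using loc[of u p] that by (auto simp: dist_norm norm_minus_commute)
    show "p \<in> U" using n d1 by (auto simp: \<eta>_def dist_norm norm_minus_commute subset_iff)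
    show "(1 / lam) *\<^sub>R (u - p) \<in> V"
      using n d2 by (auto simp: \<eta>_def dist_norm norm_minus_commute subset_iff)
    have "f xb + ereal \<eta> \<le> f xb + ereal e" by (intro add_left_mono) (simp add: \<eta>_def)
    then show "f p < f xb + ereal e" using n(3) by (rule less_le_trans[rotated])
    show "(1 / lam) *\<^sub>R (u - p) \<in> limiting_subdiff f p" by (rule prox_imp_limiting_subdiff[OF that(2)])
  qed
  have "firmly_nonexp_on (ball ub d) P" unfolding firmly_nonexp_on_def
  proof (intro ballI)
    fix x y p q assume h: "x \<in> ball ub d" "y \<in> ball ub d" "p \<in> P x" "q \<in> P y"
    have "0 \<le> inner (p - q) ((1 / lam) *\<^sub>R (x - p) - (1 / lam) *\<^sub>R (y - q))"
      using convex_limiting_subdiff_monotone[OF phi sub[OF h(1,3)] sub[OF h(2,4)]] .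
    also have "(1 / lam) *\<^sub>R (x - p) - (1 / lam) *\<^sub>R (y - q) = (1 / lam) *\<^sub>R ((x - y) - (p - q))"
      by (simp add: algebra_simps)
    finally have "0 \<le> 1 / lam * inner (p - q) ((x - y) - (p - q))" by simp
    then have "0 \<le> inner (p - q) ((x - y) - (p - q))" using lam_pos by (simp add: zero_le_divide_iff)
    then show "(norm (p - q))\<^sup>2 \<le> inner (x - y) (p - q)"
      by (simp add: power2_norm_eq_inner inner_diff_right inner_commute)
  qed
  with d show ?thesis using that by blast
qed

text \<open>Convexity of the envelope on \<open>U\<close> makes \<open>(u - p) / lam\<close> a subgradient of it at \<open>u\<close>. Evaluating
  that affine bound at \<open>y + lam *\<^sub>R v\<close>, where the envelope is at most \<open>f y + lam / 2 * (norm v)\<^sup>2\<close>,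
  cancels the quadratic terms.\<close>

lemma moreau_env_convex_imp_subgradient:
  assumes conv: "ereal_convex_on U (moreau_env lam f)" and U: "open U"
    and x: "x \<in> P (x + lam *\<^sub>R v)" "x + lam *\<^sub>R v \<in> U" and y: "y + lam *\<^sub>R v \<in> U"
  shows "f x + ereal (inner v (y - x)) \<le> f y"
proof -
  obtain c where c: "f x = ereal c" using prox_map_finite[OF proper x(1)] .
  have "convex_on U (\<lambda>u. E u)" using conv by (simp add: ereal_convex_on_moreau_env_iff)
  from convex_subgradient_of_quadratic_upper_bound[OF U x(2) y this moreau_env_quadratic_upper_bound[OF x(1)]]
  have "E (x + lam *\<^sub>R v) + inner v (y - x) \<le> E (y + lam *\<^sub>R v)" using lam_pos by simp
  moreover have "E (x + lam *\<^sub>R v) = c + 1 / (2 * lam) * (norm (lam *\<^sub>R v))\<^sup>2"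
    using moreau_env_at_prox[OF x(1)] c by simp
  moreover have "ereal (E (y + lam *\<^sub>R v)) \<le> f y + ereal (1 / (2 * lam) * (norm (lam *\<^sub>R v))\<^sup>2)"
    using moreau_env_le[of "y + lam *\<^sub>R v" y] by (subst (asm) moreau_env_finite) simp
  ultimately show ?thesis using c by (cases "f y") auto
qed

end

text \<open>With \<open>lam * rho \<le> 1\<close>, the prox-regularity inequality is at least as
  strong as the one defining level-\<open>lam\<close> proximal subgradients, on the ball where it
  holds.\<close>

locale prox_regular_setting = quadratically_minorized +
  fixes eps rho :: real
  assumes eps: "0 < eps" and rho: "lam * rho \<le> 1"
    and sub_vb: "vb \<in> limiting_subdiff f xb"
    and prox_regular: "\<And>x v y. v \<in> limiting_subdiff f x \<Longrightarrow> norm (v - vb) < eps \<Longrightarrow> norm (x - xb) < eps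
       \<Longrightarrow> f x < f xb + ereal eps \<Longrightarrow> norm (y - xb) \<le> eps
       \<Longrightarrow> f x + ereal (inner v (y - x) - rho / 2 * (norm (y - x))\<^sup>2) \<le> f y"
begin

text \<open>The proximal points of \<open>x + lam *\<^sub>R v\<close> lie in the ball where prox-regularity applies, and there
  the local quadratic bound shows that \<open>x\<close> does at least as well as any of them.\<close>

lemma limiting_subdiff_imp_prox:
  obtains k where "0 < k" "\<And>x v. v \<in> limiting_subdiff f x \<Longrightarrow> norm (v - vb) < k \<Longrightarrow> norm (x - xb) < k
       \<Longrightarrow> f x < f xb + ereal k \<Longrightarrow> x \<in> P (x + lam *\<^sub>R v)"
proof -
  obtain d where d: "d > 0" and loc: "\<And>u p. norm (u - ub) < d \<Longrightarrow> p \<in> P u \<Longrightarrow>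
     norm (p - xb) < eps \<and> norm ((1 / lam) *\<^sub>R (u - p) - vb) < eps \<and> f p < f xb + ereal eps"
    using prox_localization[OF eps] by blast
  \<comment> \<open>The bound \<open>eps\<close> allows prox-regularity at \<open>(x, v)\<close>;
    \<open>d / (1 + lam)\<close> brings \<open>x + lam *\<^sub>R v\<close> within \<open>d\<close>
    of \<open>ub\<close>.\<close>
  define k where "k = min eps (d / (1 + lam))"
  have k: "0 < k" using eps d lam_pos by (simp add: k_def)
  have k_eps: "k \<le> eps" by (simp add: k_def)
  have kd: "(1 + lam) * k \<le> d"
  proof -
    have "(1 + lam) * k \<le> (1 + lam) * (d / (1 + lam))"
      using lam_pos by (intro mult_left_mono) (auto simp: k_def)
    then show ?thesis using lam_pos by simp
  qed
  have "x \<in> P (x + lam *\<^sub>R v)"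
    if v: "v \<in> limiting_subdiff f x" "norm (v - vb) < k" and x: "norm (x - xb) < k" "f x < f xb + ereal k"
    for x v
  proof -
    define u where "u = x + lam *\<^sub>R v"
    obtain p where p: "p \<in> P u" using prox_nonempty by blast
    have "norm (p - xb) < eps"
      using loc[OF shift_near[OF x(1) v(2) kd]] p by (simp add: u_def)
    moreover have "f x < f xb + ereal eps"
      by (rule less_le_trans[OF x(2)]) (simp add: f_xb k_eps)
    ultimately have reg: "f x + ereal (inner v (p - x) - rho / 2 * (norm (p - x))\<^sup>2) \<le> f p"
      using v x by (intro prox_regular) (auto simp: k_def)
    obtain c where c: "f x = ereal c" using v(1) by (rule limiting_subdiff_finite)
    obtain c' where c': "f p = ereal c'" using prox_map_finite[OF proper p] .
    have "rho / 2 * (norm (p - x))\<^sup>2 \<le> 1 / (2 * lam) * (norm (p - x))\<^sup>2"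
      using rho lam_pos by (intro mult_right_mono) (auto simp: field_simps)
    moreover have "1 / (2 * lam) * (norm (p - u))\<^sup>2 = 1 / (2 * lam) * (norm (p - x))\<^sup>2 - inner v (p - x)
        + 1 / (2 * lam) * (norm (x - u))\<^sup>2"
      using lam_pos unfolding power2_norm_eq_inner u_def
      by (simp add: inner_diff_left inner_diff_right inner_add_left inner_add_right inner_commute field_simps)
    ultimately have "f x + ereal (1 / (2 * lam) * (norm (x - u))\<^sup>2) \<le> f p + ereal (1 / (2 * lam) * (norm (p - u))\<^sup>2)"
      using reg by (simp add: c c')
    then show ?thesis using p unfolding prox_map_def u_def by (auto intro: order_trans)
  qed
  with k show ?thesis using that by blast
qed

lemma moreau_env_convex_imp_variationally_convex:
  assumes conv: "ereal_convex_on U (moreau_env lam f)" and U: "open U" "ub \<in> U"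
  shows "variationally_convex_at f xb vb"
proof -
  obtain k where k: "0 < k" "\<And>x v. v \<in> limiting_subdiff f x \<Longrightarrow> norm (v - vb) < k \<Longrightarrow> norm (x - xb) < k
       \<Longrightarrow> f x < f xb + ereal k \<Longrightarrow> x \<in> P (x + lam *\<^sub>R v)"
    using limiting_subdiff_imp_prox by blast
  obtain d0 where d0: "d0 > 0" "ball ub d0 \<subseteq> U" using U open_contains_ball by blast
  \<comment> \<open>Within \<open>k\<close>, limiting subgradients come from proximal points; within
    \<open>d0 / (1 + lam)\<close>, both \<open>x + lam *\<^sub>R v\<close> and
    \<open>y + lam *\<^sub>R v\<close> stay in \<open>U\<close>, as the subgradient inequality for
    the pair requires.\<close>
  define d where "d = min k (d0 / (1 + lam))"
  have d: "0 < d" "d \<le> k" using k(1) d0 lam_pos by (simp_all add: d_def)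
  have "(1 + lam) * d \<le> (1 + lam) * (d0 / (1 + lam))"
    using lam_pos by (intro mult_left_mono) (auto simp: d_def)
  then have dd0: "(1 + lam) * d \<le> d0" using lam_pos by simp
  have inU: "x + lam *\<^sub>R v \<in> U" if "norm (x - xb) < d" "norm (v - vb) < d" for x v
    using shift_near[OF that dd0] d0 by (auto simp: dist_norm norm_minus_commute subset_iff)
  define S where "S = {(x, v). v \<in> limiting_subdiff f x \<and> norm (x - xb) < d \<and> norm (v - vb) < d
      \<and> f x < f xb + ereal d}"
  have f_less: "f x < f xb + ereal k" if "f x < f xb + ereal d" for x
    by (rule less_le_trans[OF that]) (use d in \<open>simp add: f_xb\<close>)
  have sub: "f x + ereal (inner v (y - x)) \<le> f y" if "(x, v) \<in> S" "norm (y - xb) < d" for x v y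
  proof (rule moreau_env_convex_imp_subgradient[OF conv U(1)])
    show "x \<in> P (x + lam *\<^sub>R v)" using that d f_less by (intro k(2)) (auto simp: S_def)
  qed (use that in \<open>auto intro!: inU simp: S_def\<close>)
  \<comment> \<open>Each affine function in the supremum lies below \<open>f\<close> near
    \<open>xb\<close> and meets \<open>f\<close> at its own base point, so \<open>phi\<close> agrees
    with \<open>f\<close> at the base points in \<open>S\<close>, and \<open>v\<close> is a
    subgradient of \<open>phi\<close> at \<open>x\<close> for each \<open>(x, v)\<close> in
    \<open>S\<close>.\<close>
  define phi where "phi y = (SUP (x, v)\<in>S. f x + ereal (inner v (y - x)))" for y
  have phi_ge: "f x + ereal (inner v (y - x)) \<le> phi y" if "(x, v) \<in> S" for x v y
    unfolding phi_def using that by (intro SUP_upper2[of "(x, v)"]) auto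
  have phi_le_f: "phi y \<le> f y" if "norm (y - xb) < d" for y
    unfolding phi_def using sub that by (intro SUP_least) auto
  have phi_eq: "f x = phi x" if "(x, v) \<in> S" for x v
  proof (rule antisym)
    show "f x \<le> phi x" using phi_ge[OF that, of x] by simp
    show "phi x \<le> f x" using that by (intro phi_le_f) (auto simp: S_def)
  qed
  have fin: "\<exists>c. f x = ereal c" if "(x, v) \<in> S" for x v
    using that limiting_subdiff_finite[of v f x] by (auto simp: S_def)
  have S_sub: "v \<in> limiting_subdiff phi x" if S: "(x, v) \<in> S" for x v
  proof -
    obtain c where c: "f x = ereal c" using fin[OF S] by blast
    show ?thesis
    proof (rule quadratic_minorant_imp_limiting_subdiff[where K = 0])
      show "phi x = ereal c" using phi_eq[OF S] c by simp
      fix y show "phi x + ereal (inner v (y - x) - 0 * (norm (y - x))\<^sup>2) \<le> phi y"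
        using phi_ge[OF S, of y] phi_eq[OF S] by simp
    qed simp
  qed
  have lsc_phi: "lsc_fun phi" unfolding lsc_fun_def
  proof (intro allI impI)
    fix y and Y :: "nat \<Rightarrow> 'a" assume Y: "Y \<longlonglongrightarrow> y"
    show "phi y \<le> liminf (\<lambda>k. phi (Y k))"
    proof (subst phi_def, rule SUP_least, clarify)
      fix x v assume S: "(x, v) \<in> S"
      obtain c where c: "f x = ereal c" using fin[OF S] by blast
      have "(\<lambda>k. ereal (c + inner v (Y k - x))) \<longlonglongrightarrow> ereal (c + inner v (y - x))"
        using Y by (intro tendsto_intros)
      then have "ereal (c + inner v (y - x)) = liminf (\<lambda>k. ereal (c + inner v (Y k - x)))"
        by (intro lim_imp_Liminf[symmetric]) simp
      also have "\<dots> \<le> liminf (\<lambda>k. phi (Y k))"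
        using phi_ge[OF S] c by (intro Liminf_mono) simp
      finally show "f x + ereal (inner v (y - x)) \<le> liminf (\<lambda>k. phi (Y k))" by (simp add: c)
    qed
  qed
  \<comment> \<open>The epigraph of the supremum is an intersection of half-spaces.\<close>
  have "{(y, s). y \<in> UNIV \<and> phi y \<le> ereal s}
      = (\<Inter>(x, v)\<in>S. {(y, s). f x + ereal (inner v (y - x)) \<le> ereal s})"
    by (auto simp: phi_def SUP_le_iff)
  moreover have "convex {(y, s). f x + ereal (inner v (y - x)) \<le> ereal s}" if S: "(x, v) \<in> S" for x v
  proof -
    obtain c where c: "f x = ereal c" using fin[OF S] by blast
    have "{(y, s). f x + ereal (inner v (y - x)) \<le> ereal s} = {z. inner (v, -1) z \<le> inner v x - c}"
      by (auto simp: c inner_diff_right inner_prod_def)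
    then show ?thesis by (simp add: convex_halfspace_le)
  qed
  ultimately have conv_phi: "ereal_convex_on UNIV phi"
    unfolding ereal_convex_on_def by (simp only:) (auto intro!: convex_INT)
  obtain d1 where d1: "d1 > 0" and loc: "\<And>u p. norm (u - ub) < d1 \<Longrightarrow> p \<in> P u \<Longrightarrow>
     norm (p - xb) < d \<and> norm ((1 / lam) *\<^sub>R (u - p) - vb) < d \<and> f p < f xb + ereal d"
    using prox_localization[OF d(1)] by blast
  define d2 where "d2 = min d (d1 / (1 + lam))"
  have d2: "0 < d2" "d2 \<le> d" using d d1 lam_pos by (simp_all add: d2_def)
  have "(1 + lam) * d2 \<le> (1 + lam) * (d1 / (1 + lam))"
    using lam_pos by (intro mult_left_mono) (auto simp: d2_def)
  then have dd1: "(1 + lam) * d2 \<le> d1" using lam_pos by simp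
  \<comment> \<open>Minty's argument again: a proximal point \<open>p\<close> of
    \<open>x + lam *\<^sub>R v\<close> gives \<open>(p, w)\<close> in \<open>S\<close> with the same
    sum, and monotonicity of the subgradients of \<open>phi\<close> identifies it with
    \<open>(x, v)\<close>.\<close>
  have in_S: "(x, v) \<in> S" if x: "norm (x - xb) < d2" and v: "norm (v - vb) < d2"
    and xv: "v \<in> limiting_subdiff phi x" for x v
  proof -
    define u where "u = x + lam *\<^sub>R v"
    obtain p where p: "p \<in> P u" using prox_nonempty by blast
    define w where "w = (1 / lam) *\<^sub>R (u - p)"
    have "norm (u - ub) < d1" unfolding u_def by (rule shift_near[OF x v dd1])
    then have S: "(p, w) \<in> S"
      using loc p prox_imp_limiting_subdiff[OF p] by (auto simp: S_def w_def)
    have "0 \<le> inner (x - p) (v - w)"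
      by (rule convex_limiting_subdiff_monotone[OF conv_phi xv S_sub[OF S]])
    moreover have xp: "x - p = - (lam *\<^sub>R (v - w))"
      using lam_pos by (simp add: w_def u_def algebra_simps)
    ultimately have "lam * inner (v - w) (v - w) \<le> 0" by simp
    then have "inner (v - w) (v - w) \<le> 0" using lam_pos by (simp add: mult_le_0_iff)
    then have "v = w" using inner_ge_zero[of "v - w"] inner_eq_zero_iff[of "v - w"] by auto
    then show ?thesis using xp S by simp
  qed
  \<comment> \<open>The neighbourhoods shrink to radius \<open>d2\<close>, but the level for
    \<open>f\<close> remains \<open>d\<close>, since membership in \<open>S\<close> already includes
    \<open>f x < f xb + ereal d\<close>.\<close>
  show ?thesis unfolding variationally_convex_at_def
  proof (rule conjI[OF sub_vb], rule exI[of _ "ball xb d2"], rule exI[of _ "ball vb d2"],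
      rule exI[of _ phi], rule exI[of _ d], intro conjI allI ballI impI)
    fix x assume "x \<in> ball xb d2"
    then show "phi x \<le> f x" using d2 by (intro phi_le_f) (auto simp: dist_norm norm_minus_commute)
  next
    fix x v assume "x \<in> ball xb d2 \<and> f x < f xb + ereal d \<and> v \<in> ball vb d2 \<and> v \<in> limiting_subdiff f x"
    then have "(x, v) \<in> S" using d2 by (auto simp: S_def dist_norm norm_minus_commute)
    then show "f x = phi x" by (rule phi_eq)
  next
    fix x v
    show "(x \<in> ball xb d2 \<and> f x < f xb + ereal d \<and> v \<in> ball vb d2 \<and> v \<in> limiting_subdiff f x)
      \<longleftrightarrow> (x \<in> ball xb d2 \<and> v \<in> ball vb d2 \<and> v \<in> limiting_subdiff phi x)" (is "?l \<longleftrightarrow> ?r")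
    proof
      assume ?l
      then have "(x, v) \<in> S" using d2 by (auto simp: S_def dist_norm norm_minus_commute)
      then show ?r using S_sub \<open>?l\<close> by blast
    next
      assume ?r
      then have "(x, v) \<in> S" by (intro in_S) (auto simp: dist_norm norm_minus_commute)
      then show ?l using \<open>?r\<close> by (auto simp: S_def)
    qed
  qed (use d d2 lsc_phi conv_phi in auto)
qed

end

section \<open>A global quadratic minorant from prox-boundedness and prox-regularity\<close>

text \<open>A real number below the envelope at one point \<open>z\<close> gives a quadratic
  minorant centred at \<open>z\<close>. Recentring at \<open>x\<close> by
  \<open>(a + b)\<^sup>2 \<le> 2 * a\<^sup>2 + 2 * b\<^sup>2\<close> doubles the
  coefficient.\<close>

lemma prox_bounded_imp_quadratic_minorant:
  fixes f :: "'a::real_inner \<Rightarrow> ereal"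
  assumes "prox_bounded f"
  obtains C K where "0 \<le> K" "\<And>y. ereal (- C - K * (norm (y - x))\<^sup>2) \<le> f y"
proof -
  obtain l z where l: "l > 0" and z: "moreau_env l f z > -\<infinity>"
    using assms by (auto simp: prox_bounded_def)
  obtain m where m: "ereal m < moreau_env l f z"
    using ereal_dense2[OF z] by (metis less_ereal.simps(3) less_imp_le MInfty_neq_ereal(1) ereal_less_ereal_Ex)
  show ?thesis
  proof (rule that[of "1 / l" "1 / l * (norm (x - z))\<^sup>2 - m"])
    fix y
    have "ereal m \<le> f y + ereal (1 / (2 * l) * (norm (y - z))\<^sup>2)"
      using m unfolding moreau_env_def by (meson INF_lower UNIV_I less_imp_le order_trans)
    then have "ereal (m - 1 / (2 * l) * (norm (y - z))\<^sup>2) \<le> f y" by (cases "f y") auto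
    moreover have "(norm (y - z))\<^sup>2 \<le> 2 * (norm (y - x))\<^sup>2 + 2 * (norm (x - z))\<^sup>2"
    proof -
      have "(norm (y - z))\<^sup>2 \<le> (norm (y - x) + norm (x - z))\<^sup>2"
        using norm_triangle_ineq[of "y - x" "x - z"] by (intro power_mono) auto
      also have "\<dots> \<le> 2 * (norm (y - x))\<^sup>2 + 2 * (norm (x - z))\<^sup>2"
        using zero_le_power2[of "norm (y - x) - norm (x - z)"]
        by (simp add: power2_eq_square algebra_simps)
      finally show ?thesis .
    qed
    then have "1 / (2 * l) * (norm (y - z))\<^sup>2 \<le> 1 / (2 * l) * (2 * (norm (y - x))\<^sup>2 + 2 * (norm (x - z))\<^sup>2)"
      using l by (intro mult_left_mono) auto
    then have "1 / (2 * l) * (norm (y - z))\<^sup>2 \<le> 1 / l * (norm (y - x))\<^sup>2 + 1 / l * (norm (x - z))\<^sup>2"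
      by (simp add: distrib_left)
    ultimately show "ereal (- (1 / l * (norm (x - z))\<^sup>2 - m) - 1 / l * (norm (y - x))\<^sup>2) \<le> f y"
      by (elim order_trans[rotated]) simp
  qed (use l in simp)
qed

text \<open>Inside the ball the local bound suffices. Outside it \<open>norm (y - x) > eps\<close>,
  so constant and linear terms are absorbed into a sufficiently steep quadratic.\<close>

lemma prox_regular_imp_global_quadratic_minorant:
  fixes f :: "'a::real_inner \<Rightarrow> ereal"
  assumes pb: "prox_bounded f" and fx: "f x = ereal c" and eps: "0 < eps"
    and loc: "\<And>y. norm (y - x) \<le> eps \<Longrightarrow> f x + ereal (inner v (y - x) - rho / 2 * (norm (y - x))\<^sup>2) \<le> f y"
  obtains r where "0 < r" "rho \<le> r"
    "\<And>y. ereal (c + inner v (y - x) - r / 2 * (norm (y - x))\<^sup>2) \<le> f y"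
proof -
  obtain C K where K: "0 \<le> K" and CK: "\<And>y. ereal (- C - K * (norm (y - x))\<^sup>2) \<le> f y"
    using prox_bounded_imp_quadratic_minorant[OF pb] by blast
  \<comment> \<open>The three summands pay for the minorant of prox-boundedness, the difference of
    the constants and the linear term.\<close>
  define R where "R = K + \<bar>C + c\<bar> / eps\<^sup>2 + norm v / eps"
  have R: "0 \<le> R" using K eps by (simp add: R_def)
  define r where "r = max rho (2 * R) + 1"
  have "ereal (c + inner v (y - x) - r / 2 * (norm (y - x))\<^sup>2) \<le> f y" for y
  proof (cases "norm (y - x) \<le> eps")
    case True
    have "rho / 2 * (norm (y - x))\<^sup>2 \<le> r / 2 * (norm (y - x))\<^sup>2"
      by (intro mult_right_mono) (auto simp: r_def)
    then have "ereal (c + inner v (y - x) - r / 2 * (norm (y - x))\<^sup>2)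
      \<le> f x + ereal (inner v (y - x) - rho / 2 * (norm (y - x))\<^sup>2)" by (simp add: fx)
    then show ?thesis using loc[OF True] by (rule order_trans)
  next
    case False
    define d where "d = norm (y - x)"
    have d: "eps < d" using False by (simp add: d_def)
    have "inner v (y - x) \<le> norm v * d" using norm_cauchy_schwarz[of v "y - x"] by (simp add: d_def)
    also have "\<dots> \<le> norm v / eps * d\<^sup>2"
    proof -
      have "norm v * d * eps \<le> norm v * d * d" using d eps by (intro mult_left_mono) auto
      then show ?thesis using eps by (simp add: field_simps power2_eq_square)
    qed
    finally have 1: "inner v (y - x) \<le> norm v / eps * d\<^sup>2" .
    have "\<bar>C + c\<bar> * eps\<^sup>2 \<le> \<bar>C + c\<bar> * d\<^sup>2" using d eps by (intro mult_left_mono power_mono) auto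
    then have "\<bar>C + c\<bar> \<le> \<bar>C + c\<bar> / eps\<^sup>2 * d\<^sup>2" using eps by (simp add: field_simps)
    then have 2: "C + c \<le> \<bar>C + c\<bar> / eps\<^sup>2 * d\<^sup>2" by linarith
    have "R * d\<^sup>2 \<le> r / 2 * d\<^sup>2" by (intro mult_right_mono) (auto simp: r_def)
    moreover have "R * d\<^sup>2 = K * d\<^sup>2 + \<bar>C + c\<bar> / eps\<^sup>2 * d\<^sup>2 + norm v / eps * d\<^sup>2"
      by (simp add: R_def distrib_right)
    ultimately have "c + inner v (y - x) - r / 2 * d\<^sup>2 \<le> - C - K * d\<^sup>2" using 1 2 by linarith
    then show ?thesis using CK[of y] unfolding d_def by (meson ereal_less_eq(3) order_trans)
  qed
  moreover have "0 < r" "rho \<le> r" using R by (auto simp: r_def)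
  ultimately show ?thesis using that by blast
qed

section \<open>The equivalences\<close>

theorem mainTheorem1:
  fixes f :: "'a::euclidean_space \<Rightarrow> ereal" and xb vb :: 'a
  assumes "proper_fun f" and "lsc_fun f" and "prox_bounded f"
    and "prox_threshold f > 0"
    and "prox_regular_at f xb vb" and "vb \<in> limiting_subdiff f xb"
  shows "\<exists>lb::real. 0 < lb \<and> ereal lb \<le> prox_threshold f \<and>
     (\<forall>lam. 0 < lam \<and> lam < lb \<longrightarrow> prox_map lam f (xb + lam *\<^sub>R vb) = {xb}) \<and>
     (\<exists>U :: real \<Rightarrow> 'a set.
        (\<forall>lam. 0 < lam \<and> lam < lb \<longrightarrow> open (U lam) \<and> convex (U lam) \<and> xb + lam *\<^sub>R vb \<in> U lam) \<and>
        (let W = (\<lambda>lam. {(x, v). x + lam *\<^sub>R v \<in> U lam});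
             a = variationally_convex_at f xb vb;
             b = (\<forall>lam. 0 < lam \<and> lam < lb \<longrightarrow> monotone_rel (prox_subdiff_level lam f) (W lam));
             c = (\<forall>lam. 0 < lam \<and> lam < lb \<longrightarrow> max_monotone_rel (prox_subdiff_level lam f) (W lam));
             d = (\<forall>lam. 0 < lam \<and> lam < lb \<longrightarrow> firmly_nonexp_on (U lam) (prox_map lam f));
             e = (\<forall>lam. 0 < lam \<and> lam < lb \<longrightarrow>
                    (\<exists>alpha. 0 < alpha \<and> alpha < 1 \<and> averaged_on alpha (U lam) (prox_map lam f)));
             f' = (\<forall>lam. 0 < lam \<and> lam < lb \<longrightarrow> nonexp_on (U lam) (prox_map lam f));
             g = (\<forall>lam. 0 < lam \<and> lam < lb \<longrightarrow> ereal_convex_on (U lam) (moreau_env lam f));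
             h = (\<exists>lam. 0 < lam \<and> lam < lb \<and> ereal_convex_on (U lam) (moreau_env lam f));
             i = (\<forall>lam. 0 < lam \<and> lam < lb \<longrightarrow> grad_cocoercive_on lam (U lam) (moreau_env lam f))
         in (a \<longleftrightarrow> b) \<and> (a \<longleftrightarrow> c) \<and> (a \<longleftrightarrow> d) \<and> (a \<longleftrightarrow> e) \<and> (a \<longleftrightarrow> f') \<and>
            (a \<longleftrightarrow> g) \<and> (a \<longleftrightarrow> h) \<and> (a \<longleftrightarrow> i)))"
proof -
  obtain fb where fb: "f xb = ereal fb" using assms(6) by (rule limiting_subdiff_finite)
  obtain eps rho where eps: "0 < eps" and
    "\<forall>x v. v \<in> limiting_subdiff f x \<and> norm (v - vb) < eps \<and> norm (x - xb) < eps \<and> f x < f xb + ereal eps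
      \<longrightarrow> (\<forall>y\<in>cball xb eps. f x + ereal (inner v (y - x) - rho / 2 * (norm (y - x))\<^sup>2) \<le> f y)"
    using assms(5) unfolding prox_regular_at_def by blast
  moreover have "y \<in> cball xb eps" if "norm (y - xb) \<le> eps" for y
    using that by (simp add: dist_norm norm_minus_commute)
  ultimately have reg: "\<And>x v y. v \<in> limiting_subdiff f x \<Longrightarrow> norm (v - vb) < eps
       \<Longrightarrow> norm (x - xb) < eps \<Longrightarrow> f x < f xb + ereal eps \<Longrightarrow> norm (y - xb) \<le> eps
       \<Longrightarrow> f x + ereal (inner v (y - x) - rho / 2 * (norm (y - x))\<^sup>2) \<le> f y"
    by blast
  have "f xb + ereal (inner vb (y - xb) - rho / 2 * (norm (y - xb))\<^sup>2) \<le> f y"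
    if "norm (y - xb) \<le> eps" for y
    using assms(6) eps that fb by (intro reg) auto
  then obtain r where r: "0 < r" "rho \<le> r" and
    minorant: "\<And>y. ereal (fb + inner vb (y - xb) - r / 2 * (norm (y - xb))\<^sup>2) \<le> f y"
    using prox_regular_imp_global_quadratic_minorant[OF assms(3) fb eps] by blast
  \<comment> \<open>Below \<open>1 / r\<close> one has \<open>lam * r < 1\<close>, and then also
    \<open>lam * rho \<le> 1\<close> because \<open>rho \<le> r\<close>.\<close>
  define lb where "lb = 1 / r"
  have lb: "0 < lb" using r by (simp add: lb_def)
  have loc: "prox_regular_setting f xb vb fb r lam eps rho" if "0 < lam" "lam < lb" for lam
  proof unfold_locales
    show lr: "lam * r < 1" using that r by (simp add: lb_def field_simps)
    have "lam * rho \<le> lam * r" using that r by (intro mult_left_mono) auto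
    then show "lam * rho \<le> 1" using lr by simp
  qed (fact assms(2) fb minorant \<open>0 < lam\<close> eps assms(6) reg)+
  have base: "quadratically_minorized f xb vb fb r lam" if "0 < lam" "lam < lb" for lam
    using loc[OF that] by (rule prox_regular_setting.axioms)
  \<comment> \<open>Every \<open>l\<close> strictly between 0 and \<open>lb\<close> has a finite
    envelope at \<open>xb\<close> and so belongs to the set defining the threshold; the bound for
    \<open>lb\<close> itself follows by density.\<close>
  have threshold: "ereal lb \<le> prox_threshold f"
  proof (rule dense_le)
    fix z assume z: "z < ereal lb"
    obtain l where l: "0 < l" "l < lb" "z \<le> ereal l"
    proof (cases "z \<le> 0")
      case True
      have "z \<le> ereal (lb / 2)" using True lb by (meson ereal_less_eq(5) half_gt_zero less_imp_le order_trans)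
      then show ?thesis using that[of "lb / 2"] lb by simp
    next
      case False
      then obtain l where "z = ereal l" using z by (cases z) auto
      then show ?thesis using that[of l] z False by simp
    qed
    have "moreau_env l f xb > -\<infinity>"
      by (subst quadratically_minorized.moreau_env_finite[OF base[OF l(1,2)]]) simp
    then have "ereal l \<le> prox_threshold f"
      unfolding prox_threshold_def using l by (intro Sup_upper) auto
    with l(3) show "z \<le> prox_threshold f" by (rule order_trans)
  qed
  \<comment> \<open>Only the passage from variational convexity needs a small neighbourhood; the passage back to it
     works for every open convex set, so \<open>UNIV\<close> will do when variational convexity fails.\<close>
  have "\<exists>U. open U \<and> convex U \<and> xb + lam *\<^sub>R vb \<in> U \<and>
      (variationally_convex_at f xb vb \<longrightarrow> firmly_nonexp_on U (prox_map lam f))"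
    if lam: "0 < lam" "lam < lb" for lam
  proof (cases "variationally_convex_at f xb vb")
    case True
    obtain d where "0 < d" "firmly_nonexp_on (ball (xb + lam *\<^sub>R vb) d) (prox_map lam f)"
      using quadratically_minorized.variationally_convex_imp_firmly_nonexp[OF base[OF lam] True] by blast
    then show ?thesis by (intro exI[of _ "ball (xb + lam *\<^sub>R vb) d"]) auto
  next
    case False
    then show ?thesis by (intro exI[of _ UNIV]) auto
  qed
  then obtain U where "\<forall>lam. 0 < lam \<and> lam < lb \<longrightarrow>
      open (U lam) \<and> convex (U lam) \<and> xb + lam *\<^sub>R vb \<in> U lam \<and>
      (variationally_convex_at f xb vb \<longrightarrow> firmly_nonexp_on (U lam) (prox_map lam f))"
    using choice[of "\<lambda>lam V. 0 < lam \<and> lam < lb \<longrightarrow>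
      open V \<and> convex V \<and> xb + lam *\<^sub>R vb \<in> V \<and>
      (variationally_convex_at f xb vb \<longrightarrow> firmly_nonexp_on V (prox_map lam f))"] by blast
  then have U: "\<And>lam. 0 < lam \<Longrightarrow> lam < lb \<Longrightarrow> open (U lam)"
    "\<And>lam. 0 < lam \<Longrightarrow> lam < lb \<Longrightarrow> convex (U lam)"
    "\<And>lam. 0 < lam \<Longrightarrow> lam < lb \<Longrightarrow> xb + lam *\<^sub>R vb \<in> U lam"
    and a_d: "\<And>lam. 0 < lam \<Longrightarrow> lam < lb \<Longrightarrow> variationally_convex_at f xb vb
      \<Longrightarrow> firmly_nonexp_on (U lam) (prox_map lam f)"
    by blast+
  have b_d: "monotone_rel (prox_subdiff_level lam f) {(x, v). x + lam *\<^sub>R v \<in> U lam}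
      \<longleftrightarrow> firmly_nonexp_on (U lam) (prox_map lam f)" if "0 < lam" for lam
    using monotone_rel_iff_firmly_nonexp[OF assms(1) that] .
  have c_b: "max_monotone_rel (prox_subdiff_level lam f) {(x, v). x + lam *\<^sub>R v \<in> U lam}
      \<longleftrightarrow> monotone_rel (prox_subdiff_level lam f) {(x, v). x + lam *\<^sub>R v \<in> U lam}"
    if "0 < lam" "lam < lb" for lam
    by (rule max_monotone_rel_iff_monotone_rel[OF assms(1) that(1)
          quadratically_minorized.prox_nonempty[OF base[OF that]]])
  have d_e: "averaged_on (1 / 2) (U lam) (prox_map lam f)"
    if "0 < lam" "lam < lb" "firmly_nonexp_on (U lam) (prox_map lam f)" for lam
    by (rule firmly_nonexp_imp_averaged[OF that(3) quadratically_minorized.prox_nonempty[OF base[OF that(1,2)]]])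
  have f_g: "ereal_convex_on (U lam) (moreau_env lam f)"
    if "0 < lam" "lam < lb" "nonexp_on (U lam) (prox_map lam f)" for lam
    by (rule quadratically_minorized.nonexp_imp_moreau_env_convex[OF base[OF that(1,2)] that(3)
          U(1)[OF that(1,2)] U(2)[OF that(1,2)]])
  have h_a: "variationally_convex_at f xb vb"
    if "0 < lam" "lam < lb" "ereal_convex_on (U lam) (moreau_env lam f)" for lam
    by (rule prox_regular_setting.moreau_env_convex_imp_variationally_convex[OF loc[OF that(1,2)] that(3)
          U(1)[OF that(1,2)] U(3)[OF that(1,2)]])
  have i_d: "grad_cocoercive_on lam (U lam) (moreau_env lam f) \<longleftrightarrow> firmly_nonexp_on (U lam) (prox_map lam f)"
    if "0 < lam" "lam < lb" for lam
    by (rule quadratically_minorized.grad_cocoercive_iff_firmly_nonexp[OF base[OF that] U(1)[OF that]])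
  \<comment> \<open>A single admissible \<open>lam\<close> is enough to return to variational
    convexity, so the properties stated for all \<open>lam\<close> are used at
    \<open>lb / 2\<close>.\<close>
  have mid: "0 < lb / 2" "lb / 2 < lb" using lb by simp_all
  let ?A = "variationally_convex_at f xb vb"
  have f_a: ?A if "\<And>lam. 0 < lam \<Longrightarrow> lam < lb \<Longrightarrow> nonexp_on (U lam) (prox_map lam f)"
    using h_a[OF mid f_g[OF mid that[OF mid]]] .
  have d_a: ?A if "\<And>lam. 0 < lam \<Longrightarrow> lam < lb \<Longrightarrow> firmly_nonexp_on (U lam) (prox_map lam f)"
    using f_a firmly_nonexp_imp_nonexp that by blast
  have a_g: "ereal_convex_on (U lam) (moreau_env lam f)" if "0 < lam" "lam < lb" ?A for lam
    using f_g[OF that(1,2) firmly_nonexp_imp_nonexp[OF a_d[OF that]]] .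
  show ?thesis
  proof (rule exI[of _ lb], intro conjI)
    show "\<forall>lam. 0 < lam \<and> lam < lb \<longrightarrow> prox_map lam f (xb + lam *\<^sub>R vb) = {xb}"
      using quadratically_minorized.prox_at_ub[OF base] by blast
    show "\<exists>U :: real \<Rightarrow> 'a set.
        (\<forall>lam. 0 < lam \<and> lam < lb \<longrightarrow> open (U lam) \<and> convex (U lam) \<and> xb + lam *\<^sub>R vb \<in> U lam) \<and>
        (let W = (\<lambda>lam. {(x, v). x + lam *\<^sub>R v \<in> U lam});
             a = variationally_convex_at f xb vb;
             b = (\<forall>lam. 0 < lam \<and> lam < lb \<longrightarrow> monotone_rel (prox_subdiff_level lam f) (W lam));
             c = (\<forall>lam. 0 < lam \<and> lam < lb \<longrightarrow> max_monotone_rel (prox_subdiff_level lam f) (W lam));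
             d = (\<forall>lam. 0 < lam \<and> lam < lb \<longrightarrow> firmly_nonexp_on (U lam) (prox_map lam f));
             e = (\<forall>lam. 0 < lam \<and> lam < lb \<longrightarrow>
                    (\<exists>alpha. 0 < alpha \<and> alpha < 1 \<and> averaged_on alpha (U lam) (prox_map lam f)));
             f' = (\<forall>lam. 0 < lam \<and> lam < lb \<longrightarrow> nonexp_on (U lam) (prox_map lam f));
             g = (\<forall>lam. 0 < lam \<and> lam < lb \<longrightarrow> ereal_convex_on (U lam) (moreau_env lam f));
             h = (\<exists>lam. 0 < lam \<and> lam < lb \<and> ereal_convex_on (U lam) (moreau_env lam f));
             i = (\<forall>lam. 0 < lam \<and> lam < lb \<longrightarrow> grad_cocoercive_on lam (U lam) (moreau_env lam f))
         in (a \<longleftrightarrow> b) \<and> (a \<longleftrightarrow> c) \<and> (a \<longleftrightarrow> d) \<and> (a \<longleftrightarrow> e) \<and> (a \<longleftrightarrow> f') \<and>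
            (a \<longleftrightarrow> g) \<and> (a \<longleftrightarrow> h) \<and> (a \<longleftrightarrow> i))"
      unfolding Let_def
    proof (rule exI[of _ U], intro conjI)
      let ?all = "\<lambda>Q. \<forall>lam. 0 < lam \<and> lam < lb \<longrightarrow> Q lam"
      show d: "?A \<longleftrightarrow> ?all (\<lambda>lam. firmly_nonexp_on (U lam) (prox_map lam f))"
        using a_d d_a by blast
      show b: "?A \<longleftrightarrow> ?all (\<lambda>lam. monotone_rel (prox_subdiff_level lam f) {(x, v). x + lam *\<^sub>R v \<in> U lam})"
        using d b_d by blast
      show "?A \<longleftrightarrow> ?all (\<lambda>lam. max_monotone_rel (prox_subdiff_level lam f) {(x, v). x + lam *\<^sub>R v \<in> U lam})"
        using b c_b by blast
      show "?A \<longleftrightarrow> ?all (\<lambda>lam. grad_cocoercive_on lam (U lam) (moreau_env lam f))"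
        using d i_d by blast
      show "?A \<longleftrightarrow> ?all (\<lambda>lam. nonexp_on (U lam) (prox_map lam f))"
        using a_d f_a firmly_nonexp_imp_nonexp by blast
      show "?A \<longleftrightarrow> ?all (\<lambda>lam. \<exists>alpha. 0 < alpha \<and> alpha < 1 \<and> averaged_on alpha (U lam) (prox_map lam f))"
      proof
        assume A: ?A
        show "?all (\<lambda>lam. \<exists>alpha. 0 < alpha \<and> alpha < 1 \<and> averaged_on alpha (U lam) (prox_map lam f))"
          using d_e a_d A by (intro allI impI exI[of _ "1 / 2"]) auto
      next
        assume "?all (\<lambda>lam. \<exists>alpha. 0 < alpha \<and> alpha < 1 \<and> averaged_on alpha (U lam) (prox_map lam f))"
        then show ?A using f_a averaged_imp_nonexp by blast
      qed
      show "?A \<longleftrightarrow> ?all (\<lambda>lam. ereal_convex_on (U lam) (moreau_env lam f))"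
        using a_g h_a mid by blast
      show "?A \<longleftrightarrow> (\<exists>lam. 0 < lam \<and> lam < lb \<and> ereal_convex_on (U lam) (moreau_env lam f))"
        using a_g h_a mid by blast
    qed (use U in blast)
  qed (fact lb threshold)+
qed

end
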